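(* Let $\pi$ be a Lagrangian Riemannian submersion from a locally conformal Kaehler manifold $(M,g,J)$, with Lee form $\omega$ and Lee vector field $B_1$, to a Riemannian manifold $(B,g_B)$. Assume $B_1\in\Gamma(\ker\pi_* )$. Then $M$ is a locally twisted product manifold of the form $M_{(\ker\pi_* )^\bot}\times_fM_{(\ker\pi_* )}$ if and only if $$\mathcal{T}_VJX=-g(X,\mathcal{T}_VV)\,\|V\|^{-2}\,JV$$ (wherever $V\neq0$) and $$g(\mathcal{A}_XJY,JV)=\tfrac12 g(JY,B_1)g(X,JV)+\tfrac12 g(X,Y)g(B_1,V)$$ for all $X,Y\in\Gamma((\ker\pi_* )^\bot)$ and $V\in\Gamma(\ker\pi_* )$, where $M_{(\ker\pi_* )^\bot}$ and $M_{(\ker\pi_* )}$ are integral manifolds of the distributions $(\ker\pi_* )^\bot$ and $\ker\pi_*$.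
   Context: Locally conformal Kaehler (l.c.K.) manifold: a Hermitian manifold $(M,J,g)$, with $\Omega(X,Y)=g(X,JY)$, for which there is a globally defined closed $1$-form $\omega$ (the Lee form) with $d\Omega=\omega\wedge\Omega$. The Lee vector field $B_1$ is defined by $g(X,B_1)=\omega(X)$; set $\theta=\omega\circ J$ and $A=-JB_1$. The Levi-Civita connection $\nabla$ of $g$ then satisfies $(\nabla_XJ)Y=\frac12\{\theta(Y)X-\omega(Y)JX-g(X,Y)A-\Omega(X,Y)B_1\}$. Riemannian submersion $\pi:(M,g)\to(B,g_B)$ (with $\dim M>\dim B$): a surjective smooth map of maximal rank whose differential $\pi_*$ preserves lengths of horizontal vectors. $\ker\pi_*$ is the vertical distribution, $(\ker\pi_* )^\bot$ the horizontal one; $\mathcal V,\mathcal H$ are the orthogonal projections onto them. O'Neill tensors: $\mathcal{A}_EF=\mathcal{H}\nabla_{\mathcal{H}E}\mathcal{V}F+\mathcal{V}\nabla_{\mathcal{H}E}\mathcal{H}F$ and $\mathcal{T}_EF=\mathcal{H}\nabla_{\mathcal{V}E}\mathcal{V}F+\mathcal{V}\nabla_{\mathcal{V}E}\mathcal{H}F$. $\pi$ is Lagrangian if $J(\ker\pi_* )=(\ker\pi_* )^\bot$. Twisted product: if $g$ is a Riemannian metric on a product $N_1\times N_2$ whose canonical foliations $\mathcal D_{N_1},\mathcal D_{N_2}$ intersect perpendicularly everywhere, then $g$ is the metric of a twisted product $N_1\times_fN_2$ if and only if $\mathcal D_{N_1}$ is a totally geodesic foliation and $\mathcal D_{N_2}$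 is a totally umbilical foliation (criterion of Ponge and Reckziegel, taken as definition in the paper). Thus being locally of the form $M_{(\ker\pi_* )^\bot}\times_fM_{(\ker\pi_* )}$ means that $(\ker\pi_* )^\bot$ defines a totally geodesic foliation and $\ker\pi_*$ a totally umbilical foliation. *)

theory Defs
  imports "HOL-Analysis.Analysis"
begin

subsection \<open>Smooth maps between Euclidean spaces\<close>

text \<open>These predicates are only used for open \<open>S\<close>.\<close>

primrec Ck_on :: "nat \<Rightarrow> 'a::euclidean_space set \<Rightarrow> ('a \<Rightarrow> 'b::euclidean_space) \<Rightarrow> bool" where
  "Ck_on 0 S f \<longleftrightarrow> continuous_on S f"
| "Ck_on (Suc k) S f \<longleftrightarrow>
     f differentiable_on S \<and> (\<forall>v. Ck_on k S (\<lambda>x. frechet_derivative f (at x) v))"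

definition smooth_on :: "'a::euclidean_space set \<Rightarrow> ('a \<Rightarrow> 'b::euclidean_space) \<Rightarrow> bool" where
  "smooth_on S f \<longleftrightarrow> (\<forall>k. Ck_on k S f)"

subsection \<open>Smooth manifolds\<close>

text \<open>The points of a manifold form a Hausdorff second countable type; its dimension is the
  dimension of the model space \<open>'a\<close>. A chart is a pair of an open domain and a coordinate map
  (whose values outside the domain are irrelevant).\<close>

type_synonym ('m, 'a) chart = "'m set \<times> ('m \<Rightarrow> 'a)"

definition is_chart :: "('m::topological_space, 'a::euclidean_space) chart \<Rightarrow> bool" where
  "is_chart c \<longleftrightarrow> open (fst c) \<and> open (snd c ` fst c) \<and>
     (\<exists>\<psi>. homeomorphism (fst c) (snd c ` fst c) (snd c) \<psi>)"

definition chart_inv :: "('m, 'a) chart \<Rightarrow> 'a \<Rightarrow> 'm" where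
  "chart_inv c = inv_into (fst c) (snd c)"

definition chart_compatible ::
    "('m, 'a::euclidean_space) chart \<Rightarrow> ('m, 'a) chart \<Rightarrow> bool" where
  "chart_compatible c d \<longleftrightarrow>
     smooth_on (snd c ` (fst c \<inter> fst d)) (snd d \<circ> chart_inv c) \<and>
     smooth_on (snd d ` (fst c \<inter> fst d)) (snd c \<circ> chart_inv d)"

definition smooth_structure ::
    "('m::{t2_space,second_countable_topology}, 'a::euclidean_space) chart set \<Rightarrow> bool" where
  "smooth_structure M \<longleftrightarrow>
     (\<forall>c\<in>M. is_chart c) \<and> (\<Union>c\<in>M. fst c) = UNIV \<and>
     (\<forall>c\<in>M. \<forall>d\<in>M. chart_compatible c d) \<and>
     (\<forall>c. is_chart c \<and> (\<forall>d\<in>M. chart_compatible c d) \<longrightarrow> c \<in> M)"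

text \<open>The tangent space at \<open>p\<close> is the model space \<open>'a\<close>, a vector being given by its components
  with respect to the preferred chart \<open>chart_at M p\<close>. All chart-dependent notions below go
  through \<open>mderiv\<close>, so the choice of preferred charts only fixes the linear identification of
  each individual tangent space with \<open>'a\<close>.\<close>

definition chart_at :: "('m, 'a) chart set \<Rightarrow> 'm \<Rightarrow> ('m, 'a) chart" where
  "chart_at M p = (SOME c. c \<in> M \<and> p \<in> fst c)"

text \<open>\<open>mderiv M f p v\<close> is \<open>df\<^sub>p(v)\<close> for a function \<open>f\<close> with values in a Euclidean space. In
  particular \<open>mderiv M (snd c) p v\<close> is the component vector of \<open>v\<close> in the chart \<open>c\<close>.\<close>

definition mderiv ::
    "('m, 'a::euclidean_space) chart set \<Rightarrow> ('m \<Rightarrow> 'c::euclidean_space) \<Rightarrow> 'm \<Rightarrow> 'a \<Rightarrow> 'c" where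
  "mderiv M f p =
     frechet_derivative (f \<circ> chart_inv (chart_at M p)) (at (snd (chart_at M p) p))"

definition smooth_fun ::
    "('m, 'a::euclidean_space) chart set \<Rightarrow> ('m \<Rightarrow> 'c::euclidean_space) \<Rightarrow> bool" where
  "smooth_fun M f \<longleftrightarrow> (\<forall>c\<in>M. smooth_on (snd c ` fst c) (f \<circ> chart_inv c))"

definition smooth_map ::
    "('m::topological_space, 'a::euclidean_space) chart set \<Rightarrow>
     ('n::topological_space, 'b::euclidean_space) chart set \<Rightarrow> ('m \<Rightarrow> 'n) \<Rightarrow> bool" where
  "smooth_map M N \<pi> \<longleftrightarrow> continuous_on UNIV \<pi> \<and>
     (\<forall>c\<in>M. \<forall>d\<in>N. smooth_on (snd c ` (fst c \<inter> \<pi> -` fst d)) (snd d \<circ> \<pi> \<circ> chart_inv c))"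

definition differential ::
    "('m, 'a::euclidean_space) chart set \<Rightarrow> ('n, 'b::euclidean_space) chart set \<Rightarrow>
     ('m \<Rightarrow> 'n) \<Rightarrow> 'm \<Rightarrow> 'a \<Rightarrow> 'b" where
  "differential M N \<pi> p = mderiv M (snd (chart_at N (\<pi> p)) \<circ> \<pi>) p"

subsection \<open>Vector fields, forms and metrics\<close>

definition smooth_field :: "('m, 'a::euclidean_space) chart set \<Rightarrow> ('m \<Rightarrow> 'a) \<Rightarrow> bool" where
  "smooth_field M X \<longleftrightarrow>
     (\<forall>c\<in>M. smooth_on (snd c ` fst c) ((\<lambda>p. mderiv M (snd c) p (X p)) \<circ> chart_inv c))"

definition sections :: "('m, 'a::euclidean_space) chart set \<Rightarrow> ('m \<Rightarrow> 'a set) \<Rightarrow> ('m \<Rightarrow> 'a) set" where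
  "sections M D = {X. smooth_field M X \<and> (\<forall>p. X p \<in> D p)}"

text \<open>In the coordinates of the preferred chart at \<open>p\<close>, this is
  \<open>[X,Y]\<^sub>p = DY(X\<^sub>p) - DX(Y\<^sub>p)\<close>.\<close>

definition lie_bracket ::
    "('m, 'a::euclidean_space) chart set \<Rightarrow> ('m \<Rightarrow> 'a) \<Rightarrow> ('m \<Rightarrow> 'a) \<Rightarrow> 'm \<Rightarrow> 'a" where
  "lie_bracket M X Y p =
     (let \<phi> = snd (chart_at M p) in
        mderiv M (\<lambda>q. mderiv M \<phi> q (Y q)) p (X p) - mderiv M (\<lambda>q. mderiv M \<phi> q (X q)) p (Y p))"

definition field_deriv ::
    "('m, 'a::euclidean_space) chart set \<Rightarrow> ('m \<Rightarrow> 'a) \<Rightarrow> ('m \<Rightarrow> real) \<Rightarrow> 'm \<Rightarrow> real" where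
  "field_deriv M X f p = mderiv M f p (X p)"

definition smooth_one_form ::
    "('m, 'a::euclidean_space) chart set \<Rightarrow> ('m \<Rightarrow> 'a \<Rightarrow> real) \<Rightarrow> bool" where
  "smooth_one_form M \<omega> \<longleftrightarrow> (\<forall>p. linear (\<omega> p)) \<and>
     (\<forall>X. smooth_field M X \<longrightarrow> smooth_fun M (\<lambda>p. \<omega> p (X p)))"

definition ext_deriv1 ::
    "('m, 'a::euclidean_space) chart set \<Rightarrow> ('m \<Rightarrow> 'a \<Rightarrow> real) \<Rightarrow>
     ('m \<Rightarrow> 'a) \<Rightarrow> ('m \<Rightarrow> 'a) \<Rightarrow> 'm \<Rightarrow> real" where
  "ext_deriv1 M \<omega> X Y p =
     field_deriv M X (\<lambda>q. \<omega> q (Y q)) p - field_deriv M Y (\<lambda>q. \<omega> q (X q)) p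
     - \<omega> p (lie_bracket M X Y p)"

definition ext_deriv2 ::
    "('m, 'a::euclidean_space) chart set \<Rightarrow> ('m \<Rightarrow> 'a \<Rightarrow> 'a \<Rightarrow> real) \<Rightarrow>
     ('m \<Rightarrow> 'a) \<Rightarrow> ('m \<Rightarrow> 'a) \<Rightarrow> ('m \<Rightarrow> 'a) \<Rightarrow> 'm \<Rightarrow> real" where
  "ext_deriv2 M \<Omega> X Y Z p =
     field_deriv M X (\<lambda>q. \<Omega> q (Y q) (Z q)) p
     + field_deriv M Y (\<lambda>q. \<Omega> q (Z q) (X q)) p
     + field_deriv M Z (\<lambda>q. \<Omega> q (X q) (Y q)) p
     - \<Omega> p (lie_bracket M X Y p) (Z p)
     - \<Omega> p (lie_bracket M Y Z p) (X p)
     - \<Omega> p (lie_bracket M Z X p) (Y p)"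

definition wedge12 :: "('a \<Rightarrow> real) \<Rightarrow> ('a \<Rightarrow> 'a \<Rightarrow> real) \<Rightarrow> 'a \<Rightarrow> 'a \<Rightarrow> 'a \<Rightarrow> real" where
  "wedge12 \<omega> \<Omega> u v w = \<omega> u * \<Omega> v w + \<omega> v * \<Omega> w u + \<omega> w * \<Omega> u v"

definition riemannian_metric ::
    "('m, 'a::euclidean_space) chart set \<Rightarrow> ('m \<Rightarrow> 'a \<Rightarrow> 'a \<Rightarrow> real) \<Rightarrow> bool" where
  "riemannian_metric M g \<longleftrightarrow>
     (\<forall>p. bilinear (g p) \<and> (\<forall>u v. g p u v = g p v u) \<and> (\<forall>v. v \<noteq> 0 \<longrightarrow> g p v v > 0)) \<and>
     (\<forall>X Y. smooth_field M X \<longrightarrow> smooth_field M Y \<longrightarrow> smooth_fun M (\<lambda>p. g p (X p) (Y p)))"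

definition riemannian_manifold ::
    "('m::{t2_space,second_countable_topology}, 'a::euclidean_space) chart set \<Rightarrow>
     ('m \<Rightarrow> 'a \<Rightarrow> 'a \<Rightarrow> real) \<Rightarrow> bool" where
  "riemannian_manifold M g \<longleftrightarrow> smooth_structure M \<and> riemannian_metric M g"

text \<open>The Levi-Civita connection as an operator on smooth vector fields; its values on other
  functions \<open>'m \<Rightarrow> 'a\<close> are unconstrained.\<close>

definition levi_civita ::
    "('m, 'a::euclidean_space) chart set \<Rightarrow> ('m \<Rightarrow> 'a \<Rightarrow> 'a \<Rightarrow> real) \<Rightarrow>
     (('m \<Rightarrow> 'a) \<Rightarrow> ('m \<Rightarrow> 'a) \<Rightarrow> 'm \<Rightarrow> 'a) \<Rightarrow> bool" where
  "levi_civita M g nabla \<longleftrightarrow>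
     (\<forall>X Y. smooth_field M X \<longrightarrow> smooth_field M Y \<longrightarrow> smooth_field M (nabla X Y)) \<and>
     (\<forall>X X' Y p. smooth_field M X \<longrightarrow> smooth_field M X' \<longrightarrow> smooth_field M Y \<longrightarrow>
        nabla (\<lambda>q. X q + X' q) Y p = nabla X Y p + nabla X' Y p) \<and>
     (\<forall>f X Y p. smooth_fun M f \<longrightarrow> smooth_field M X \<longrightarrow> smooth_field M Y \<longrightarrow>
        nabla (\<lambda>q. f q *\<^sub>R X q) Y p = f p *\<^sub>R nabla X Y p) \<and>
     (\<forall>X Y Y' p. smooth_field M X \<longrightarrow> smooth_field M Y \<longrightarrow> smooth_field M Y' \<longrightarrow>
        nabla X (\<lambda>q. Y q + Y' q) p = nabla X Y p + nabla X Y' p) \<and>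
     (\<forall>f X Y p. smooth_fun M f \<longrightarrow> smooth_field M X \<longrightarrow> smooth_field M Y \<longrightarrow>
        nabla X (\<lambda>q. f q *\<^sub>R Y q) p = field_deriv M X f p *\<^sub>R Y p + f p *\<^sub>R nabla X Y p) \<and>
     (\<forall>X Y Z p. smooth_field M X \<longrightarrow> smooth_field M Y \<longrightarrow> smooth_field M Z \<longrightarrow>
        field_deriv M X (\<lambda>q. g q (Y q) (Z q)) p =
          g p (nabla X Y p) (Z p) + g p (Y p) (nabla X Z p)) \<and>
     (\<forall>X Y p. smooth_field M X \<longrightarrow> smooth_field M Y \<longrightarrow>
        nabla X Y p - nabla Y X p = lie_bracket M X Y p)"

subsection \<open>Locally conformal Kaehler manifolds\<close>

text \<open>\<open>J\<close> comes from a complex manifold structure: around each point there is a chart in whose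
  coordinates \<open>J\<close> is a constant endomorphism \<open>J\<^sub>0\<close> of the model space (so, up to a linear
  coordinate change, multiplication by the imaginary unit). This includes smoothness of \<open>J\<close>.\<close>

definition complex_structure ::
    "('m, 'a::euclidean_space) chart set \<Rightarrow> ('m \<Rightarrow> 'a \<Rightarrow> 'a) \<Rightarrow> bool" where
  "complex_structure M J \<longleftrightarrow>
     (\<forall>p. linear (J p) \<and> (\<forall>v. J p (J p v) = - v)) \<and>
     (\<forall>p. \<exists>c\<in>M. p \<in> fst c \<and>
        (\<exists>J\<^sub>0. linear J\<^sub>0 \<and>
           (\<forall>q\<in>fst c. \<forall>v. mderiv M (snd c) q (J q v) = J\<^sub>0 (mderiv M (snd c) q v))))"

definition hermitian_manifold ::
    "('m::{t2_space,second_countable_topology}, 'a::euclidean_space) chart set \<Rightarrow>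
     ('m \<Rightarrow> 'a \<Rightarrow> 'a) \<Rightarrow> ('m \<Rightarrow> 'a \<Rightarrow> 'a \<Rightarrow> real) \<Rightarrow> bool" where
  "hermitian_manifold M J g \<longleftrightarrow>
     riemannian_manifold M g \<and> complex_structure M J \<and>
     (\<forall>p u v. g p (J p u) (J p v) = g p u v)"

definition fundamental_form ::
    "('m \<Rightarrow> 'a \<Rightarrow> 'a) \<Rightarrow> ('m \<Rightarrow> 'a \<Rightarrow> 'a \<Rightarrow> real) \<Rightarrow> 'm \<Rightarrow> 'a \<Rightarrow> 'a \<Rightarrow> real" where
  "fundamental_form J g p u v = g p u (J p v)"

text \<open>Locally conformal Kaehler, with Lee form \<open>\<omega>\<close>.\<close>

definition lck_manifold ::
    "('m::{t2_space,second_countable_topology}, 'a::euclidean_space) chart set \<Rightarrow>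
     ('m \<Rightarrow> 'a \<Rightarrow> 'a) \<Rightarrow> ('m \<Rightarrow> 'a \<Rightarrow> 'a \<Rightarrow> real) \<Rightarrow> ('m \<Rightarrow> 'a \<Rightarrow> real) \<Rightarrow> bool" where
  "lck_manifold M J g \<omega> \<longleftrightarrow>
     hermitian_manifold M J g \<and> smooth_one_form M \<omega> \<and>
     (\<forall>X Y p. smooth_field M X \<longrightarrow> smooth_field M Y \<longrightarrow> ext_deriv1 M \<omega> X Y p = 0) \<and>
     (\<forall>X Y Z p. smooth_field M X \<longrightarrow> smooth_field M Y \<longrightarrow> smooth_field M Z \<longrightarrow>
        ext_deriv2 M (fundamental_form J g) X Y Z p =
          wedge12 (\<omega> p) (fundamental_form J g p) (X p) (Y p) (Z p))"

definition is_lee_field ::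
    "('m \<Rightarrow> 'a \<Rightarrow> 'a \<Rightarrow> real) \<Rightarrow> ('m \<Rightarrow> 'a \<Rightarrow> real) \<Rightarrow> ('m \<Rightarrow> 'a) \<Rightarrow> bool" where
  "is_lee_field g \<omega> B\<^sub>1 \<longleftrightarrow> (\<forall>p v. g p v (B\<^sub>1 p) = \<omega> p v)"

definition apply_field :: "('m \<Rightarrow> 'a \<Rightarrow> 'a) \<Rightarrow> ('m \<Rightarrow> 'a) \<Rightarrow> 'm \<Rightarrow> 'a" where
  "apply_field J X p = J p (X p)"

subsection \<open>Riemannian submersions and the tensors of O'Neill\<close>

definition orth_compl :: "('a \<Rightarrow> 'a \<Rightarrow> real) \<Rightarrow> 'a set \<Rightarrow> 'a set" where
  "orth_compl G S = {v. \<forall>u\<in>S. G v u = 0}"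

definition orth_proj :: "('a \<Rightarrow> 'a \<Rightarrow> real) \<Rightarrow> 'a::euclidean_space set \<Rightarrow> 'a \<Rightarrow> 'a" where
  "orth_proj G S v = (THE u. u \<in> S \<and> v - u \<in> orth_compl G S)"

definition vertical ::
    "('m, 'a::euclidean_space) chart set \<Rightarrow> ('n, 'b::euclidean_space) chart set \<Rightarrow>
     ('m \<Rightarrow> 'n) \<Rightarrow> 'm \<Rightarrow> 'a set" where
  "vertical M N \<pi> p = {v. differential M N \<pi> p v = 0}"

definition horizontal ::
    "('m, 'a::euclidean_space) chart set \<Rightarrow> ('m \<Rightarrow> 'a \<Rightarrow> 'a \<Rightarrow> real) \<Rightarrow>
     ('n, 'b::euclidean_space) chart set \<Rightarrow> ('m \<Rightarrow> 'n) \<Rightarrow> 'm \<Rightarrow> 'a set" where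
  "horizontal M g N \<pi> p = orth_compl (g p) (vertical M N \<pi> p)"

definition riemannian_submersion ::
    "('m::topological_space, 'a::euclidean_space) chart set \<Rightarrow> ('m \<Rightarrow> 'a \<Rightarrow> 'a \<Rightarrow> real) \<Rightarrow>
     ('n::topological_space, 'b::euclidean_space) chart set \<Rightarrow> ('n \<Rightarrow> 'b \<Rightarrow> 'b \<Rightarrow> real) \<Rightarrow>
     ('m \<Rightarrow> 'n) \<Rightarrow> bool" where
  "riemannian_submersion M g N h \<pi> \<longleftrightarrow>
     DIM('b) < DIM('a) \<and> smooth_map M N \<pi> \<and> surj \<pi> \<and>
     (\<forall>p. surj (differential M N \<pi> p)) \<and>
     (\<forall>p. \<forall>v\<in>horizontal M g N \<pi> p.
        h (\<pi> p) (differential M N \<pi> p v) (differential M N \<pi> p v) = g p v v)"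

definition lagrangian_submersion ::
    "('m, 'a::euclidean_space) chart set \<Rightarrow> ('m \<Rightarrow> 'a \<Rightarrow> 'a \<Rightarrow> real) \<Rightarrow> ('m \<Rightarrow> 'a \<Rightarrow> 'a) \<Rightarrow>
     ('n, 'b::euclidean_space) chart set \<Rightarrow> ('m \<Rightarrow> 'n) \<Rightarrow> bool" where
  "lagrangian_submersion M g J N \<pi> \<longleftrightarrow>
     (\<forall>p. J p ` vertical M N \<pi> p = horizontal M g N \<pi> p)"

definition vert ::
    "('m, 'a::euclidean_space) chart set \<Rightarrow> ('m \<Rightarrow> 'a \<Rightarrow> 'a \<Rightarrow> real) \<Rightarrow>
     ('n, 'b::euclidean_space) chart set \<Rightarrow> ('m \<Rightarrow> 'n) \<Rightarrow> ('m \<Rightarrow> 'a) \<Rightarrow> 'm \<Rightarrow> 'a" where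
  "vert M g N \<pi> E p = orth_proj (g p) (vertical M N \<pi> p) (E p)"

definition horiz ::
    "('m, 'a::euclidean_space) chart set \<Rightarrow> ('m \<Rightarrow> 'a \<Rightarrow> 'a \<Rightarrow> real) \<Rightarrow>
     ('n, 'b::euclidean_space) chart set \<Rightarrow> ('m \<Rightarrow> 'n) \<Rightarrow> ('m \<Rightarrow> 'a) \<Rightarrow> 'm \<Rightarrow> 'a" where
  "horiz M g N \<pi> E p = orth_proj (g p) (horizontal M g N \<pi> p) (E p)"

definition oneill_A ::
    "('m, 'a::euclidean_space) chart set \<Rightarrow> ('m \<Rightarrow> 'a \<Rightarrow> 'a \<Rightarrow> real) \<Rightarrow>
     (('m \<Rightarrow> 'a) \<Rightarrow> ('m \<Rightarrow> 'a) \<Rightarrow> 'm \<Rightarrow> 'a) \<Rightarrow> ('n, 'b::euclidean_space) chart set \<Rightarrow>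
     ('m \<Rightarrow> 'n) \<Rightarrow> ('m \<Rightarrow> 'a) \<Rightarrow> ('m \<Rightarrow> 'a) \<Rightarrow> 'm \<Rightarrow> 'a" where
  "oneill_A M g nabla N \<pi> E F p =
     horiz M g N \<pi> (nabla (horiz M g N \<pi> E) (vert M g N \<pi> F)) p +
     vert M g N \<pi> (nabla (horiz M g N \<pi> E) (horiz M g N \<pi> F)) p"

definition oneill_T ::
    "('m, 'a::euclidean_space) chart set \<Rightarrow> ('m \<Rightarrow> 'a \<Rightarrow> 'a \<Rightarrow> real) \<Rightarrow>
     (('m \<Rightarrow> 'a) \<Rightarrow> ('m \<Rightarrow> 'a) \<Rightarrow> 'm \<Rightarrow> 'a) \<Rightarrow> ('n, 'b::euclidean_space) chart set \<Rightarrow>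
     ('m \<Rightarrow> 'n) \<Rightarrow> ('m \<Rightarrow> 'a) \<Rightarrow> ('m \<Rightarrow> 'a) \<Rightarrow> 'm \<Rightarrow> 'a" where
  "oneill_T M g nabla N \<pi> E F p =
     horiz M g N \<pi> (nabla (vert M g N \<pi> E) (vert M g N \<pi> F)) p +
     vert M g N \<pi> (nabla (vert M g N \<pi> E) (horiz M g N \<pi> F)) p"

subsection \<open>Foliations and twisted products\<close>

text \<open>A distribution (of constant rank) is integrable, i.e. tangent to a foliation, iff it is
  closed under the Lie bracket.\<close>

definition integrable_distribution ::
    "('m, 'a::euclidean_space) chart set \<Rightarrow> ('m \<Rightarrow> 'a set) \<Rightarrow> bool" where
  "integrable_distribution M D \<longleftrightarrow>
     (\<forall>X\<in>sections M D. \<forall>Y\<in>sections M D. lie_bracket M X Y \<in> sections M D)"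

definition totally_geodesic_foliation ::
    "('m, 'a::euclidean_space) chart set \<Rightarrow>
     (('m \<Rightarrow> 'a) \<Rightarrow> ('m \<Rightarrow> 'a) \<Rightarrow> 'm \<Rightarrow> 'a) \<Rightarrow> ('m \<Rightarrow> 'a set) \<Rightarrow> bool" where
  "totally_geodesic_foliation M nabla D \<longleftrightarrow> integrable_distribution M D \<and>
     (\<forall>X\<in>sections M D. \<forall>Y\<in>sections M D. nabla X Y \<in> sections M D)"

text \<open>The second fundamental form of the leaves is \<open>h(U,V) = g(U,V) H\<close>, with mean curvature
  vector field \<open>H\<close>.\<close>

definition totally_umbilical_foliation ::
    "('m, 'a::euclidean_space) chart set \<Rightarrow> ('m \<Rightarrow> 'a \<Rightarrow> 'a \<Rightarrow> real) \<Rightarrow>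
     (('m \<Rightarrow> 'a) \<Rightarrow> ('m \<Rightarrow> 'a) \<Rightarrow> 'm \<Rightarrow> 'a) \<Rightarrow> ('m \<Rightarrow> 'a set) \<Rightarrow> bool" where
  "totally_umbilical_foliation M g nabla D \<longleftrightarrow> integrable_distribution M D \<and>
     (\<exists>H\<in>sections M (\<lambda>p. orth_compl (g p) (D p)).
        \<forall>U\<in>sections M D. \<forall>V\<in>sections M D. \<forall>p.
          orth_proj (g p) (orth_compl (g p) (D p)) (nabla U V p) = g p (U p) (V p) *\<^sub>R H p)"

text \<open>Locally of the form \<open>N\<^sub>1 \<times>\<^sub>f N\<^sub>2\<close> with \<open>N\<^sub>1\<close>, \<open>N\<^sub>2\<close> integral manifolds of \<open>D\<^sub>1\<close>, \<open>D\<^sub>2\<close>, in the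
  sense of the criterion of Ponge and Reckziegel.\<close>

definition locally_twisted_product ::
    "('m, 'a::euclidean_space) chart set \<Rightarrow> ('m \<Rightarrow> 'a \<Rightarrow> 'a \<Rightarrow> real) \<Rightarrow>
     (('m \<Rightarrow> 'a) \<Rightarrow> ('m \<Rightarrow> 'a) \<Rightarrow> 'm \<Rightarrow> 'a) \<Rightarrow> ('m \<Rightarrow> 'a set) \<Rightarrow> ('m \<Rightarrow> 'a set) \<Rightarrow> bool" where
  "locally_twisted_product M g nabla D\<^sub>1 D\<^sub>2 \<longleftrightarrow>
     (\<forall>p. D\<^sub>2 p = orth_compl (g p) (D\<^sub>1 p)) \<and>
     totally_geodesic_foliation M nabla D\<^sub>1 \<and>
     totally_umbilical_foliation M g nabla D\<^sub>2"

end

theory Submission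
  imports Defs
begin

text \<open>Let \<open>H\<close> and \<open>V\<close> be the horizontal and vertical distributions. The l.c.K. formula for \<open>\<nabla>J\<close>,
  with the Lee field vertical, turns the condition on \<open>\<A>\<close> into \<open>g(\<nabla>\<^sub>X Y, V) = 0\<close>, that is, into \<open>H\<close> being
  totally geodesic. The same formula shows that \<open>C(U,V,W) = g(\<nabla>\<^sub>U V, JW)\<close> is totally symmetric on
  vertical fields, hence tensorial. If the fibres are umbilical with mean curvature field \<open>K\<close>, the
  symmetry of \<open>g(U,V) g(K,JW)\<close> is the condition on \<open>\<T>\<close>. Conversely, that condition forces the second
  fundamental form to satisfy \<open>h(V,U) = g(V,U) K\<^sub>V\<close> with \<open>K\<^sub>V = C(V,V,V) |V|\<^sup>-\<^sup>4 JV\<close>, and the symmetry of \<open>h\<close> makes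
  \<open>K\<^sub>V\<close> independent of \<open>V\<close> (it is zero unless the fibres are one-dimensional). To pass from fields
  to vectors one needs a global vertical field through every vertical vector, which is built
  locally and cut off with a bump function.\<close>

subsection \<open>Smooth maps between Euclidean spaces\<close>

text \<open>Two features of the encoding shape the proof. Tangent vectors are coordinates in a
  preferred chart that jumps from point to point, so brackets and verticality are treated through
  the action of fields on smooth functions, and the bracket then calls for the symmetry of second
  derivatives. Moreover \<open>nabla\<close> is an operator on global smooth fields, so every
  pointwise statement about it has to pass through global sections. The formula for \<nabla>J is
  derived, in weak form. For a torsion-free metric connection, d\<Omega> is a cyclic sum of terms in
  \<nabla>J, and d\<Omega>(X,Y,Z) - d\<Omega>(X,JY,JZ) isolates 2 g(Y, (\<nabla>_X J) Z) once the
  Nijenhuis tensor vanishes; it vanishes because J is constant in suitable charts.\<close>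

abbreviation fderiv :: "('a::real_normed_vector \<Rightarrow> 'b::real_normed_vector) \<Rightarrow> 'a \<Rightarrow> 'a \<Rightarrow> 'b" where
  "fderiv f x \<equiv> frechet_derivative f (at x)"

text \<open>Locally equal functions have the same derivatives, so the choice hidden in
  \<open>frechet_derivative\<close> picks the same value, even at points where no derivative
  exists.\<close>

lemma fderiv_cong_open:
  assumes "open S" "x \<in> S" "\<And>y. y \<in> S \<Longrightarrow> f y = g y"
  shows "fderiv f x = fderiv g x"
proof -
  have "(f has_derivative f') (at x) \<longleftrightarrow> (g has_derivative f') (at x)" for f'
    by (metis assms has_derivative_transform_within_open)
  then show ?thesis
    unfolding frechet_derivative_def by simp
qed

lemma differentiable_cong_open:
  assumes "open S" "x \<in> S" "\<And>y. y \<in> S \<Longrightarrow> f y = g y"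
  shows "f differentiable (at x) \<longleftrightarrow> g differentiable (at x)"
proof -
  have "(f has_derivative f') (at x) \<longleftrightarrow> (g has_derivative f') (at x)" for f'
    by (metis assms has_derivative_transform_within_open)
  then show ?thesis
    unfolding differentiable_def by simp
qed

lemma Ck_on_cong:
  assumes "open S" "\<And>x. x \<in> S \<Longrightarrow> f x = g x"
  shows "Ck_on k S f \<longleftrightarrow> Ck_on k S g"
  using assms
proof (induction k arbitrary: f g)
  case 0
  then show ?case by (simp cong: continuous_on_cong)
next
  case (Suc k)
  have 1: "f differentiable_on S \<longleftrightarrow> g differentiable_on S"
    using differentiable_cong_open[OF Suc.prems(1) _ Suc.prems(2)]
    by (simp add: differentiable_on_eq_differentiable_at[OF Suc.prems(1)])
  have 2: "Ck_on k S (\<lambda>x. fderiv f x v) \<longleftrightarrow> Ck_on k S (\<lambda>x. fderiv g x v)" for v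
    by (rule Suc.IH[OF Suc.prems(1)]) (use Suc.prems fderiv_cong_open in metis)
  show ?case using 1 2 by simp
qed

lemma Ck_on_subset:
  assumes "Ck_on k S f" "open S" "open T" "T \<subseteq> S"
  shows "Ck_on k T f"
  using assms
proof (induction k arbitrary: f)
  case 0
  then show ?case using continuous_on_subset by auto
next
  case (Suc k)
  then show ?case using differentiable_on_subset by auto
qed

text \<open>The gluing principle behind all chart-wise arguments; S is open because it is a union of
  the sets T.\<close>

lemma Ck_on_local:
  assumes "\<And>x. x \<in> S \<Longrightarrow> \<exists>T. open T \<and> x \<in> T \<and> T \<subseteq> S \<and> Ck_on k T f"
  shows "Ck_on k S f"
proof -
  have S: "open S" using assms by (metis Topological_Spaces.openI)
  show ?thesis
    using assms
  proof (induction k arbitrary: f)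
    case 0
    have "isCont f x" if "x \<in> S" for x
      using 0[OF that] continuous_on_eq_continuous_at by auto
    then show ?case by (simp add: continuous_at_imp_continuous_on)
  next
    case (Suc k)
    have "f differentiable (at x)" if "x \<in> S" for x
      using Suc.prems[OF that] by (auto simp: differentiable_on_eq_differentiable_at)
    moreover have "Ck_on k S (\<lambda>x. fderiv f x v)" for v
      using Suc.prems by (intro Suc.IH) (metis Ck_on.simps(2))
    ultimately show ?case
      using S by (simp add: differentiable_on_eq_differentiable_at)
  qed
qed

lemma Ck_on_SucD: "Ck_on (Suc k) S f \<Longrightarrow> Ck_on k S f"
proof (induction k arbitrary: f)
  case 0
  then show ?case by (simp add: differentiable_imp_continuous_on)
next
  case (Suc k)
  then show ?case by simp
qed

lemma Ck_on_const [simp]: "Ck_on k S (\<lambda>x. c)"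
  by (induction k arbitrary: c) simp_all

text \<open>Any explicit derivative may stand in for the chosen one; most closure properties below
  are inductions on k through this rule.\<close>

lemma Ck_on_SucI:
  assumes "open S" "\<And>x. x \<in> S \<Longrightarrow> (f has_derivative f' x) (at x)"
    "\<And>v. Ck_on k S (\<lambda>x. f' x v)"
  shows "Ck_on (Suc k) S f"
proof -
  have "f differentiable_on S"
    using assms(1,2) by (auto simp: differentiable_on_eq_differentiable_at differentiable_def)
  moreover have "Ck_on k S (\<lambda>x. fderiv f x v)" for v
    using assms(3)[of v]
  proof (rule Ck_on_cong[THEN iffD1, OF assms(1), rotated])
    show "f' x v = fderiv f x v" if "x \<in> S" for x
      using frechet_derivative_at[OF assms(2)[OF that]] by simp
  qed
  ultimately show ?thesis by simp
qed

lemma Ck_on_SucE: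
  assumes "Ck_on (Suc k) S f" "open S" "x \<in> S"
  shows "(f has_derivative fderiv f x) (at x)"
  using assms by (auto simp: differentiable_on_eq_differentiable_at frechet_derivative_works)

lemma Ck_on_linear:
  fixes f :: "'a::euclidean_space \<Rightarrow> 'b::euclidean_space"
  assumes "bounded_linear f" "open S" shows "Ck_on k S f"
proof (cases k)
  case 0
  then show ?thesis using assms by (simp add: linear_continuous_on)
next
  case (Suc n)
  show ?thesis unfolding Suc
    by (rule Ck_on_SucI[where f'="\<lambda>_. f", OF assms(2)])
       (use assms bounded_linear_imp_has_derivative in auto)
qed

lemma Ck_on_add:
  assumes "open S" "Ck_on k S f" "Ck_on k S g"
  shows "Ck_on k S (\<lambda>x. f x + g x)"
  using assms
proof (induction k arbitrary: f g)
  case 0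
  then show ?case by (simp add: continuous_on_add)
next
  case (Suc k)
  show ?case
  proof (rule Ck_on_SucI[OF Suc.prems(1)])
    show "((\<lambda>x. f x + g x) has_derivative (\<lambda>v. fderiv f x v + fderiv g x v)) (at x)"
      if "x \<in> S" for x
      using that Suc.prems Ck_on_SucE by (intro has_derivative_add) blast+
  qed (use Suc in auto)
qed

lemma Ck_on_bilinear:
  fixes h :: "'b::euclidean_space \<Rightarrow> 'c::euclidean_space \<Rightarrow> 'd::euclidean_space"
  assumes h: "bounded_bilinear h" and S: "open S" and "Ck_on k S f" "Ck_on k S g"
  shows "Ck_on k S (\<lambda>x. h (f x) (g x))"
  using assms(3,4)
proof (induction k arbitrary: f g)
  case 0
  then show ?case using h by (simp add: bounded_bilinear.continuous_on)
next
  case (Suc k)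
  show ?case
  proof (rule Ck_on_SucI[OF S])
    show "((\<lambda>x. h (f x) (g x)) has_derivative
        (\<lambda>v. h (f x) (fderiv g x v) + h (fderiv f x v) (g x))) (at x)"
      if "x \<in> S" for x
      using that Suc.prems S by (auto intro!: bounded_bilinear.FDERIV[OF h] Ck_on_SucE)
    fix v
    have "Ck_on k S f" "Ck_on k S g"
      using Suc.prems by (blast intro: Ck_on_SucD)+
    moreover have "Ck_on k S (\<lambda>x. fderiv f x v)" "Ck_on k S (\<lambda>x. fderiv g x v)"
      using Suc.prems by auto
    ultimately show "Ck_on k S (\<lambda>x. h (f x) (fderiv g x v) + h (fderiv f x v) (g x))"
      using S Suc.IH by (intro Ck_on_add) auto
  qed
qed

lemma Ck_on_sum:
  assumes "open S" "\<And>i. i \<in> I \<Longrightarrow> Ck_on k S (f i)"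
  shows "Ck_on k S (\<lambda>x. \<Sum>i\<in>I. f i x)"
  using assms(2)
proof (induction I rule: infinite_finite_induct)
  case (insert i I)
  then show ?case using assms(1) by (simp add: Ck_on_add)
qed simp_all

lemma has_derivative_sum_Basis:
  assumes "(f has_derivative f') (at x)"
  shows "f' u = (\<Sum>b\<in>Basis. (u \<bullet> b) *\<^sub>R f' (b::'a::euclidean_space))"
proof -
  interpret linear f' using assms by (rule has_derivative_linear)
  have "f' u = f' (\<Sum>b\<in>Basis. (u \<bullet> b) *\<^sub>R b)"
    by (simp add: euclidean_representation)
  then show ?thesis by (simp add: sum scale)
qed

text \<open>\<open>Ck_on\<close> controls derivatives in fixed directions only, while the chain rule
  needs a direction that varies with x; expanding it in \<open>Basis\<close> bridges the gap. The
  regularity of the derivative is assumed after composition with \<phi>, because in the induction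
  for composites exactly this is the induction hypothesis.\<close>

lemma Ck_on_fderiv_apply:
  fixes f :: "'a::euclidean_space \<Rightarrow> 'b::euclidean_space" and u :: "'c::euclidean_space \<Rightarrow> 'a"
  assumes T: "open T" and S: "open S" and \<phi>: "\<And>x. x \<in> S \<Longrightarrow> \<phi> x \<in> T"
    and f: "f differentiable_on T" and f': "\<And>v. Ck_on k S (\<lambda>x. fderiv f (\<phi> x) v)"
    and u: "Ck_on k S u"
  shows "Ck_on k S (\<lambda>x. fderiv f (\<phi> x) (u x))"
proof -
  have "Ck_on k S (\<lambda>x. \<Sum>b\<in>Basis. (u x \<bullet> b) *\<^sub>R fderiv f (\<phi> x) b)"
    using f' S u
    by (intro Ck_on_sum S Ck_on_bilinear[OF bounded_bilinear_scaleR] Ck_on_bilinear[OF bounded_bilinear_inner])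
       auto
  then show ?thesis
  proof (rule Ck_on_cong[THEN iffD1, OF S, rotated])
    fix x assume "x \<in> S"
    then have "(f has_derivative fderiv f (\<phi> x)) (at (\<phi> x))"
      using f T \<phi> by (auto simp: differentiable_on_eq_differentiable_at frechet_derivative_works)
    then show "(\<Sum>b\<in>Basis. (u x \<bullet> b) *\<^sub>R fderiv f (\<phi> x) b) = fderiv f (\<phi> x) (u x)"
      by (simp add: has_derivative_sum_Basis)
  qed
qed

text \<open>The induction generalises over g: the hypothesis is applied to the directional
  derivatives of g, with the same inner f.\<close>

lemma Ck_on_compose:
  fixes f :: "'a::euclidean_space \<Rightarrow> 'b::euclidean_space"
    and g :: "'b \<Rightarrow> 'c::euclidean_space"
  assumes T: "open T" and S: "open S" and fST: "\<And>x. x \<in> S \<Longrightarrow> f x \<in> T"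
    and "Ck_on k S f" "Ck_on k T g"
  shows "Ck_on k S (\<lambda>x. g (f x))"
  using assms(4,5)
proof (induction k arbitrary: g)
  case 0
  then show ?case
    using continuous_on_compose2[of T g S f] fST by (simp add: image_subset_iff)
next
  case (Suc k)
  show ?case
  proof (rule Ck_on_SucI[OF S])
    show "((\<lambda>x. g (f x)) has_derivative (\<lambda>v. fderiv g (f x) (fderiv f x v))) (at x)"
      if "x \<in> S" for x
      using that fST diff_chain_at[OF Ck_on_SucE[OF Suc.prems(1) S that] Ck_on_SucE[OF Suc.prems(2) T]]
      by (simp add: o_def)
    fix v
    have "Ck_on k S (\<lambda>x. fderiv g (f x) w)" for w
      by (rule Suc.IH[OF Ck_on_SucD[OF Suc.prems(1)]]) (use Suc.prems in simp)
    from Ck_on_fderiv_apply[OF T S fST _ this] 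
    show "Ck_on k S (\<lambda>x. fderiv g (f x) (fderiv f x v))"
      using Suc.prems by auto
  qed
qed

lemma Ck_on_inverse:
  fixes f :: "'a::euclidean_space \<Rightarrow> real"
  assumes S: "open S" and nz: "\<And>x. x \<in> S \<Longrightarrow> f x \<noteq> 0" and "Ck_on k S f"
  shows "Ck_on k S (\<lambda>x. inverse (f x))"
  using assms(3)
proof (induction k)
  case 0
  then show ?case using nz by (simp add: continuous_on_inverse)
next
  case (Suc k)
  show ?case
  proof (rule Ck_on_SucI[OF S])
    show "((\<lambda>x. inverse (f x)) has_derivative
        (\<lambda>v. - (inverse (f x) * fderiv f x v * inverse (f x)))) (at x)"
      if "x \<in> S" for x
      using nz[OF that] Ck_on_SucE[OF Suc.prems S that] by (rule Deriv.has_derivative_inverse)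
    fix v
    have "Ck_on k S (\<lambda>x. inverse (f x))" "Ck_on k S (\<lambda>x. fderiv f x v)"
      using Suc.IH[OF Ck_on_SucD[OF Suc.prems]] Suc.prems by auto
    then have "Ck_on k S (\<lambda>x. (-1) * (inverse (f x) * fderiv f x v * inverse (f x)))"
      using S by (intro Ck_on_bilinear[OF bounded_bilinear_mult] Ck_on_const) auto
    then show "Ck_on k S (\<lambda>x. - (inverse (f x) * fderiv f x v * inverse (f x)))"
      by simp
  qed
qed

section \<open>Smoothness of all orders: closure properties\<close>

lemma smooth_on_cong:
  "open S \<Longrightarrow> (\<And>x. x \<in> S \<Longrightarrow> f x = g x) \<Longrightarrow> smooth_on S f \<longleftrightarrow> smooth_on S g"
  unfolding smooth_on_def using Ck_on_cong by blast

lemma smooth_on_subset: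
  "smooth_on S f \<Longrightarrow> open S \<Longrightarrow> open T \<Longrightarrow> T \<subseteq> S \<Longrightarrow> smooth_on T f"
  unfolding smooth_on_def using Ck_on_subset by blast

lemma smooth_on_local:
  "(\<And>x. x \<in> S \<Longrightarrow> \<exists>T. open T \<and> x \<in> T \<and> T \<subseteq> S \<and> smooth_on T f) \<Longrightarrow> smooth_on S f"
  unfolding smooth_on_def by (metis Ck_on_local)

lemma smooth_on_const [simp]: "smooth_on S (\<lambda>x. c)"
  unfolding smooth_on_def by simp

lemma smooth_on_linear:
  fixes f :: "'a::euclidean_space \<Rightarrow> 'b::euclidean_space"
  shows "bounded_linear f \<Longrightarrow> open S \<Longrightarrow> smooth_on S f"
  unfolding smooth_on_def by (simp add: Ck_on_linear)

lemma smooth_on_add: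
  "open S \<Longrightarrow> smooth_on S f \<Longrightarrow> smooth_on S g \<Longrightarrow> smooth_on S (\<lambda>x. f x + g x)"
  unfolding smooth_on_def by (simp add: Ck_on_add)

lemma smooth_on_bilinear:
  fixes h :: "'b::euclidean_space \<Rightarrow> 'c::euclidean_space \<Rightarrow> 'd::euclidean_space"
  shows "bounded_bilinear h \<Longrightarrow> open S \<Longrightarrow> smooth_on S f \<Longrightarrow> smooth_on S g \<Longrightarrow>
    smooth_on S (\<lambda>x. h (f x) (g x))"
  unfolding smooth_on_def by (simp add: Ck_on_bilinear)

lemmas smooth_on_scaleR = smooth_on_bilinear[OF bounded_bilinear_scaleR]

lemma smooth_on_compose:
  fixes f :: "'a::euclidean_space \<Rightarrow> 'b::euclidean_space"
    and g :: "'b \<Rightarrow> 'c::euclidean_space"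
  shows "smooth_on T g \<Longrightarrow> smooth_on S f \<Longrightarrow> open T \<Longrightarrow> open S \<Longrightarrow> (\<And>x. x \<in> S \<Longrightarrow> f x \<in> T) \<Longrightarrow>
    smooth_on S (\<lambda>x. g (f x))"
  unfolding smooth_on_def using Ck_on_compose by blast

lemma smooth_on_inverse:
  fixes f :: "'a::euclidean_space \<Rightarrow> real"
  shows "open S \<Longrightarrow> smooth_on S f \<Longrightarrow> (\<And>x. x \<in> S \<Longrightarrow> f x \<noteq> 0) \<Longrightarrow> smooth_on S (\<lambda>x. inverse (f x))"
  unfolding smooth_on_def by (simp add: Ck_on_inverse)

lemma smooth_on_differentiable:
  "smooth_on S f \<Longrightarrow> open S \<Longrightarrow> x \<in> S \<Longrightarrow> f differentiable (at x)"
  unfolding smooth_on_def using Ck_on.simps(2) differentiable_on_eq_differentiable_at by blast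

lemma smooth_on_has_derivative:
  "smooth_on S f \<Longrightarrow> open S \<Longrightarrow> x \<in> S \<Longrightarrow> (f has_derivative fderiv f x) (at x)"
  using smooth_on_differentiable frechet_derivative_works by blast

lemma smooth_on_fderiv: "smooth_on S f \<Longrightarrow> smooth_on S (\<lambda>x. fderiv f x v)"
  unfolding smooth_on_def by (metis Ck_on.simps(2))

lemma smooth_on_fderiv_apply:
  fixes f :: "'a::euclidean_space \<Rightarrow> 'b::euclidean_space"
  assumes f: "smooth_on T f" and "open T" and \<phi>: "smooth_on S \<phi>" and "open S"
    and "\<And>x. x \<in> S \<Longrightarrow> \<phi> x \<in> T" and "smooth_on S u"
  shows "smooth_on S (\<lambda>x. fderiv f (\<phi> x) (u x))"
proof -
  have "smooth_on S (\<lambda>x. fderiv f (\<phi> x) v)" for v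
    using smooth_on_compose[OF smooth_on_fderiv[OF f] \<phi>] assms by blast
  moreover have "f differentiable_on T"
    using f unfolding smooth_on_def by (metis Ck_on.simps(2))
  ultimately show ?thesis
    using assms Ck_on_fderiv_apply[of T S \<phi> f _ u] unfolding smooth_on_def by presburger
qed

text \<open>A mixed second difference quotient is, by the mean value theorem, a value of each of the two
  mixed second derivatives at nearby points.\<close>

lemma fderiv_commute:
  fixes f :: "'a::euclidean_space \<Rightarrow> 'b::euclidean_space"
  assumes f: "smooth_on S f" and S: "open S" and x: "x \<in> S"
  shows "fderiv (\<lambda>y. fderiv f y u) x v = fderiv (\<lambda>y. fderiv f y v) x u"
proof -
  define G where "G u v b y = fderiv (\<lambda>y. fderiv f y u) y v \<bullet> b" for u v b y
  obtain r where r: "r > 0" "ball x r \<subseteq> S" using S x openE by blast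
  have diff_f: "(f has_derivative fderiv f y) (at y)" if "y \<in> S" for y
    using smooth_on_has_derivative[OF f S that] .
  have diff_f': "((\<lambda>y. fderiv f y u) has_derivative fderiv (\<lambda>y. fderiv f y u) y) (at y)"
    if "y \<in> S" for y u
    using smooth_on_has_derivative[OF smooth_on_fderiv[OF f] S that] .
  have contG: "isCont (G u v b) x" for u v b
  proof -
    have "smooth_on S (\<lambda>y. fderiv (\<lambda>y. fderiv f y u) y v)"
      using f smooth_on_fderiv by blast
    then have "isCont (\<lambda>y. fderiv (\<lambda>y. fderiv f y u) y v) x"
      using smooth_on_differentiable S x differentiable_imp_continuous_within by blast
    then show ?thesis unfolding G_def by (intro continuous_intros)
  qed
  define \<Delta> where "\<Delta> u v b s = (f (x + s *\<^sub>R u + s *\<^sub>R v) - f (x + s *\<^sub>R u) - f (x + s *\<^sub>R v) + f x) \<bullet> b"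
    for u v b and s :: real
  have key: "\<exists>y. norm (y - x) \<le> s * (norm u + norm v) \<and> \<Delta> u v b s = s * s * G u v b y"
    if s: "0 < s" "s * (norm u + norm v) < r" for s u v b
  proof -
    have inS: "x + t *\<^sub>R u + t' *\<^sub>R v \<in> S" if "0 \<le> t" "t \<le> s" "0 \<le> t'" "t' \<le> s" for t t'
    proof -
      have "norm (t *\<^sub>R u + t' *\<^sub>R v) \<le> t * norm u + t' * norm v"
        using that norm_triangle_ineq[of "t *\<^sub>R u" "t' *\<^sub>R v"] by simp
      also have "\<dots> \<le> s * norm u + s * norm v"
        using that by (intro add_mono mult_right_mono) auto
      finally have "norm (t *\<^sub>R u + t' *\<^sub>R v) < r" using s by (simp add: algebra_simps)
      moreover have "dist x (x + t *\<^sub>R u + t' *\<^sub>R v) = norm (t *\<^sub>R u + t' *\<^sub>R v)"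
        by (metis add.assoc add_diff_cancel_left' dist_commute dist_norm)
      ultimately show ?thesis using r by auto
    qed
    let ?\<phi> = "\<lambda>t. (f (x + t *\<^sub>R u + s *\<^sub>R v) - f (x + t *\<^sub>R u)) \<bullet> b"
    let ?\<phi>' = "\<lambda>t. (fderiv f (x + t *\<^sub>R u + s *\<^sub>R v) u - fderiv f (x + t *\<^sub>R u) u) \<bullet> b"
    have path: "((\<lambda>t. f (p + t *\<^sub>R w)) has_derivative (\<lambda>h. h *\<^sub>R fderiv f (p + t *\<^sub>R w) w)) (at t)"
      if "p + t *\<^sub>R w \<in> S" for p w and t :: real
    proof -
      have "((\<lambda>t. p + t *\<^sub>R w) has_derivative (\<lambda>h. h *\<^sub>R w)) (at t)"
        by (auto intro!: derivative_eq_intros)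
      from diff_chain_at[OF this diff_f[OF that]] 
      have "((\<lambda>t. f (p + t *\<^sub>R w)) has_derivative (\<lambda>h. fderiv f (p + t *\<^sub>R w) (h *\<^sub>R w))) (at t)"
        by (simp add: o_def)
      then show ?thesis
        using linear_scale[OF has_derivative_linear[OF diff_f[OF that]]] by simp
    qed
    have path': "((\<lambda>t. fderiv f (p + t *\<^sub>R w) u) has_derivative
        (\<lambda>h. h *\<^sub>R fderiv (\<lambda>y. fderiv f y u) (p + t *\<^sub>R w) w)) (at t)"
      if "p + t *\<^sub>R w \<in> S" for p w and t :: real
    proof -
      have "((\<lambda>t. p + t *\<^sub>R w) has_derivative (\<lambda>h. h *\<^sub>R w)) (at t)"
        by (auto intro!: derivative_eq_intros)
      from diff_chain_at[OF this diff_f'[OF that]] 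
      have "((\<lambda>t. fderiv f (p + t *\<^sub>R w) u) has_derivative
          (\<lambda>h. fderiv (\<lambda>y. fderiv f y u) (p + t *\<^sub>R w) (h *\<^sub>R w))) (at t)"
        by (simp add: o_def)
      then show ?thesis
        using linear_scale[OF has_derivative_linear[OF diff_f'[OF that]]] by simp
    qed
    have d\<phi>: "DERIV ?\<phi> t :> ?\<phi>' t" if "0 \<le> t" "t \<le> s" for t
    proof -
      have 1: "((\<lambda>t. f (x + t *\<^sub>R u + s *\<^sub>R v)) has_derivative (\<lambda>h. h *\<^sub>R fderiv f (x + t *\<^sub>R u + s *\<^sub>R v) u)) (at t)"
        using path[of "x + s *\<^sub>R v" t u] inS[of t s] that s by (simp add: algebra_simps)
      have 2: "((\<lambda>t. f (x + t *\<^sub>R u)) has_derivative (\<lambda>h. h *\<^sub>R fderiv f (x + t *\<^sub>R u) u)) (at t)"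
        using path[of x t u] inS[of t 0] that s by simp
      have "(?\<phi> has_derivative (\<lambda>h. (h *\<^sub>R fderiv f (x + t *\<^sub>R u + s *\<^sub>R v) u - h *\<^sub>R fderiv f (x + t *\<^sub>R u) u) \<bullet> b)) (at t)"
        by (intro has_derivative_inner_left has_derivative_diff 1 2)
      then show ?thesis
        by (rule has_derivative_imp_has_field_derivative) (simp add: algebra_simps)
    qed
    obtain z where z: "0 < z" "z < s" "?\<phi> s - ?\<phi> 0 = (s - 0) * ?\<phi>' z"
      using MVT2[of 0 s ?\<phi> ?\<phi>'] s d\<phi> by blast
    let ?\<psi> = "\<lambda>t. fderiv f (x + z *\<^sub>R u + t *\<^sub>R v) u \<bullet> b"
    have d\<psi>: "DERIV ?\<psi> t :> G u v b (x + z *\<^sub>R u + t *\<^sub>R v)" if "0 \<le> t" "t \<le> s" for t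
    proof -
      have "(?\<psi> has_derivative (\<lambda>h. (h *\<^sub>R fderiv (\<lambda>y. fderiv f y u) (x + z *\<^sub>R u + t *\<^sub>R v) v) \<bullet> b)) (at t)"
        using that s z by (intro has_derivative_inner_left path' inS) auto
      then show ?thesis
        by (rule has_derivative_imp_has_field_derivative) (simp add: G_def)
    qed
    obtain w where w: "0 < w" "w < s" "?\<psi> s - ?\<psi> 0 = (s - 0) * G u v b (x + z *\<^sub>R u + w *\<^sub>R v)"
      using MVT2[of 0 s ?\<psi> "\<lambda>t. G u v b (x + z *\<^sub>R u + t *\<^sub>R v)"] s d\<psi> by blast
    have "\<Delta> u v b s = ?\<phi> s - ?\<phi> 0"
      unfolding \<Delta>_def by (simp add: algebra_simps)
    also have "\<dots> = s * (?\<psi> s - ?\<psi> 0)"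
      unfolding z(3) by (simp add: inner_diff_left)
    also have "\<dots> = s * s * G u v b (x + z *\<^sub>R u + w *\<^sub>R v)"
      unfolding w(3) by simp
    finally have "\<Delta> u v b s = s * s * G u v b (x + z *\<^sub>R u + w *\<^sub>R v)" .
    moreover have "norm (x + z *\<^sub>R u + w *\<^sub>R v - x) \<le> s * (norm u + norm v)"
    proof -
      have "norm (z *\<^sub>R u + w *\<^sub>R v) \<le> z * norm u + w * norm v"
        using z w norm_triangle_ineq[of "z *\<^sub>R u" "w *\<^sub>R v"] by simp
      also have "\<dots> \<le> s * norm u + s * norm v"
        using z w by (intro add_mono mult_right_mono) auto
      finally show ?thesis by (simp add: algebra_simps)
    qed
    ultimately show ?thesis by blast
  qed
  have lim: "((\<lambda>s. \<Delta> u v b s / (s * s)) \<longlongrightarrow> G u v b x) (at_right 0)" for u v b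
  proof (rule tendstoI)
    fix e :: real assume "e > 0"
    with contG[of u v b] obtain d where d: "d > 0" "\<And>y. dist y x < d \<Longrightarrow> dist (G u v b y) (G u v b x) < e"
      unfolding continuous_at_eps_delta by blast
    \<comment> \<open>The summand 1 keeps the denominator positive when u = v = 0.\<close>
    define d' where "d' = min r d / (norm u + norm v + 1)"
    have d': "d' > 0" unfolding d'_def using r d
      by (intro divide_pos_pos) (auto intro: add_nonneg_pos)
    have "dist (\<Delta> u v b s / (s * s)) (G u v b x) < e" if s: "0 < s" "s < d'" for s
    proof -
      have "s * (norm u + norm v + 1) < min r d"
        using s d' unfolding d'_def by (simp add: pos_less_divide_eq add_nonneg_pos)
      then have sm: "s * (norm u + norm v) < min r d" using s by (simp add: algebra_simps)
      then obtain y where "norm (y - x) \<le> s * (norm u + norm v)" "\<Delta> u v b s = s * s * G u v b y"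
        using key[of s u v b] s by auto
      then show ?thesis using sm s d(2)[of y] by (simp add: dist_norm)
    qed
    then show "\<forall>\<^sub>F s in at_right 0. dist (\<Delta> u v b s / (s * s)) (G u v b x) < e"
      unfolding eventually_at_right_field using d' by auto
  qed
  have "\<Delta> u v b = \<Delta> v u b" for b
    unfolding \<Delta>_def by (auto simp: fun_eq_iff algebra_simps)
  then have "G u v b x = G v u b x" for b
    using lim[of u v b] lim[of v u b] tendsto_unique[OF trivial_limit_at_right_real] by metis
  then show ?thesis
    unfolding G_def by (metis euclidean_eqI)
qed


subsection \<open>Bump functions\<close>

text \<open>The classical function exp(-1/t), extended by 0, multiplied by powers of 1/t. The powers
  make the span of the family closed under differentiation, so that smoothness of all members is a
  single induction.\<close>

definition flat :: "nat \<Rightarrow> real \<Rightarrow> real" where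
  "flat k t = (if t > 0 then inverse t ^ k * exp (- inverse t) else 0)"

lemma flat_tendsto_0: "(flat k \<longlongrightarrow> 0) (at 0)"
proof (rule filterlim_split_at)
  show "(flat k \<longlongrightarrow> 0) (at_left 0)"
    by (rule tendsto_eventually) (auto simp: flat_def eventually_at_filter)
  have "((\<lambda>t. inverse t ^ k / exp (inverse t)) \<longlongrightarrow> (0::real)) (at_right 0)"
    using filterlim_compose[OF tendsto_power_div_exp_0 filterlim_inverse_at_top_right] .
  then show "(flat k \<longlongrightarrow> 0) (at_right 0)"
  proof (rule Lim_transform_eventually)
    show "\<forall>\<^sub>F t in at_right 0. inverse t ^ k / exp (inverse t) = flat k t"
      by (auto simp: flat_def eventually_at_filter exp_minus field_simps)
  qed
qed

lemma flat_has_derivative: "DERIV (flat k) t :> flat (k + 2) t - real k * flat (k + 1) t"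
proof (cases "t = 0")
  case True
  \<comment> \<open>The difference quotient of \<open>flat k\<close> at 0 is
    \<open>flat (k + 1)\<close>.\<close>
  have "((\<lambda>t. (flat k t - flat k 0) / (t - 0)) \<longlongrightarrow> 0) (at 0)"
    using flat_tendsto_0[of "k + 1"]
    by (rule Lim_transform_eventually)
       (auto simp: flat_def eventually_at_filter field_simps intro!: always_eventually)
  then show ?thesis
    unfolding True has_field_derivative_iff by (simp add: flat_def)
next
  case False
  show ?thesis
  proof (cases "t > 0")
    case True
    let ?d = "real k * inverse t ^ (k - 1) * (- (inverse t * inverse t)) * exp (- inverse t) +
        inverse t ^ k * (exp (- inverse t) * (inverse t * inverse t))"
    have "?d = flat (k + 2) t - real k * flat (k + 1) t"
      using True by (cases k) (auto simp: flat_def algebra_simps)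
    moreover have "DERIV (\<lambda>t. inverse t ^ k * exp (- inverse t)) t :> ?d"
      using True by (auto intro!: derivative_eq_intros simp: power2_eq_square)
    ultimately have "DERIV (\<lambda>t. inverse t ^ k * exp (- inverse t)) t :>
        flat (k + 2) t - real k * flat (k + 1) t"
      by simp
    then show ?thesis
    proof (rule has_field_derivative_transform_within_open)
      show "open {0::real<..}" by simp
    qed (use True in \<open>auto simp: flat_def\<close>)
  next
    case F: False
    have "DERIV (\<lambda>t. 0::real) t :> 0" by simp
    then have "DERIV (flat k) t :> 0"
    proof (rule has_field_derivative_transform_within_open)
      show "open {..<0::real}" by simp
    qed (use F False in \<open>auto simp: flat_def\<close>)
    then show ?thesis using F by (simp add: flat_def)
  qed
qed

lemma smooth_on_flat: "smooth_on UNIV (flat k)"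
proof -
  have "Ck_on n UNIV (flat k)" for n
  proof (induction n arbitrary: k)
    case 0
    show ?case
      using DERIV_isCont[OF flat_has_derivative] by (simp add: continuous_at_imp_continuous_on)
  next
    case (Suc n)
    show ?case
    proof (rule Ck_on_SucI[OF open_UNIV])
      show "(flat k has_derivative (\<lambda>v. (flat (k + 2) t - real k * flat (k + 1) t) * v)) (at t)" for t
        using flat_has_derivative[of k t] by (simp add: has_field_derivative_def)
      fix v :: real
      have "Ck_on n UNIV (\<lambda>t. (flat (k + 2) t + (- real k) * flat (k + 1) t) * v)"
        by (intro Ck_on_bilinear[OF bounded_bilinear_mult] Ck_on_add Ck_on_const Suc open_UNIV)
      then show "Ck_on n UNIV (\<lambda>t. (flat (k + 2) t - real k * flat (k + 1) t) * v)"
        by simp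
    qed
  qed
  then show ?thesis unfolding smooth_on_def by blast
qed

lemma smooth_bump:
  fixes x :: "'a::euclidean_space"
  assumes "r > 0"
  obtains \<beta> :: "'a \<Rightarrow> real" where "smooth_on UNIV \<beta>" "\<beta> x = 1" "\<And>y. y \<notin> cball x r \<Longrightarrow> \<beta> y = 0"
proof
  \<comment> \<open>\<open>flat 0\<close> of r^2 - |y - x|^2, normalised to be 1 at the centre. The
    differences are spelled as sums and products because these are the operations covered by the
    closure lemmas.\<close>
  define \<beta> where "\<beta> y = inverse (flat 0 (r\<^sup>2)) * flat 0 (r\<^sup>2 + (-1) * ((y + - x) \<bullet> (y + - x)))" for y
  have id: "smooth_on UNIV (\<lambda>y::'a. y)"
    by (rule smooth_on_linear) (auto simp: bounded_linear_ident)
  have "smooth_on UNIV (\<lambda>y. r\<^sup>2 + (-1) * ((y + - x) \<bullet> (y + - x)))"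
    by (intro smooth_on_add smooth_on_bilinear[OF bounded_bilinear_mult]
          smooth_on_bilinear[OF bounded_bilinear_inner] smooth_on_const open_UNIV id)
  from smooth_on_compose[OF smooth_on_flat this] show "smooth_on UNIV \<beta>"
    unfolding \<beta>_def by (intro smooth_on_bilinear[OF bounded_bilinear_mult]) auto
  show "\<beta> x = 1" using assms by (simp add: \<beta>_def flat_def)
  show "\<beta> y = 0" if "y \<notin> cball x r" for y
  proof -
    have "r < norm (y - x)" using that by (simp add: dist_norm norm_minus_commute)
    then have "r\<^sup>2 \<le> (norm (y - x))\<^sup>2" using assms by (intro power_mono) auto
    then show ?thesis unfolding \<beta>_def flat_def by (simp add: power2_norm_eq_inner)
  qed
qed

text \<open>The Leibniz rule for the derivative of F along a field Y. It separates the second-order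
  term of F, which cancels in a commutator by symmetry, from the term that survives in the
  bracket.\<close>

lemma fderiv_fderiv_apply:
  fixes F :: "'a::euclidean_space \<Rightarrow> 'b::euclidean_space"
  assumes F: "smooth_on S F" and Y: "smooth_on S Y" and S: "open S" and x: "x \<in> S"
  shows "fderiv (\<lambda>y. fderiv F y (Y y)) x v =
    fderiv (\<lambda>y. fderiv F y (Y x)) x v + fderiv F x (fderiv Y x v)"
proof -
  have expand: "fderiv F y u = (\<Sum>b\<in>Basis. (u \<bullet> b) *\<^sub>R fderiv F y b)" if "y \<in> S" for y u
    using has_derivative_sum_Basis[OF smooth_on_has_derivative[OF F S that]] .
  have dF: "((\<lambda>y. fderiv F y b) has_derivative fderiv (\<lambda>y. fderiv F y b) x) (at x)" for b
    by (rule smooth_on_has_derivative[OF smooth_on_fderiv[OF F] S x])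
  have 1: "((\<lambda>y. \<Sum>b\<in>Basis. (Y y \<bullet> b) *\<^sub>R fderiv F y b) has_derivative
      (\<lambda>v. \<Sum>b\<in>Basis. (Y x \<bullet> b) *\<^sub>R fderiv (\<lambda>y. fderiv F y b) x v + (fderiv Y x v \<bullet> b) *\<^sub>R fderiv F x b)) (at x)"
    by (intro has_derivative_sum has_derivative_scaleR has_derivative_inner_left dF
        smooth_on_has_derivative[OF Y S x])
  have 2: "((\<lambda>y. \<Sum>b\<in>Basis. (Y x \<bullet> b) *\<^sub>R fderiv F y b) has_derivative
      (\<lambda>v. \<Sum>b\<in>Basis. (Y x \<bullet> b) *\<^sub>R fderiv (\<lambda>y. fderiv F y b) x v)) (at x)"
    by (intro has_derivative_sum has_derivative_scaleR_right dF)
  have "fderiv (\<lambda>y. fderiv F y (Y y)) x = fderiv (\<lambda>y. \<Sum>b\<in>Basis. (Y y \<bullet> b) *\<^sub>R fderiv F y b) x"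
    by (rule fderiv_cong_open[OF S x]) (rule expand)
  note this[folded frechet_derivative_at[OF 1]]
  moreover have "fderiv (\<lambda>y. fderiv F y (Y x)) x = fderiv (\<lambda>y. \<Sum>b\<in>Basis. (Y x \<bullet> b) *\<^sub>R fderiv F y b) x"
    by (rule fderiv_cong_open[OF S x]) (rule expand)
  note this[folded frechet_derivative_at[OF 2]]
  ultimately show ?thesis
    using expand[OF x, of "fderiv Y x v"] by (simp add: sum.distrib)
qed

subsection \<open>Local smoothness on manifolds\<close>

text \<open>Charts, the coordinates of \<pi> and fields with constant coordinates are smooth on open
  sets only, hence the versions relative to U.\<close>

definition smooth_fun_on ::
    "('m, 'a::euclidean_space) chart set \<Rightarrow> 'm set \<Rightarrow> ('m \<Rightarrow> 'c::euclidean_space) \<Rightarrow> bool" where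
  "smooth_fun_on M U f \<longleftrightarrow> (\<forall>c\<in>M. smooth_on (snd c ` (fst c \<inter> U)) (f \<circ> chart_inv c))"

definition smooth_field_on ::
    "('m, 'a::euclidean_space) chart set \<Rightarrow> 'm set \<Rightarrow> ('m \<Rightarrow> 'a) \<Rightarrow> bool" where
  "smooth_field_on M U X \<longleftrightarrow>
     (\<forall>c\<in>M. smooth_on (snd c ` (fst c \<inter> U)) ((\<lambda>p. mderiv M (snd c) p (X p)) \<circ> chart_inv c))"

lemma smooth_fun_onE:
  "smooth_fun_on M U f \<Longrightarrow> c \<in> M \<Longrightarrow> smooth_on (snd c ` (fst c \<inter> U)) (\<lambda>x. f (chart_inv c x))"
  unfolding smooth_fun_on_def by (simp add: o_def)

lemma smooth_field_onE:
  "smooth_field_on M U X \<Longrightarrow> c \<in> M \<Longrightarrow>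
    smooth_on (snd c ` (fst c \<inter> U)) (\<lambda>x. mderiv M (snd c) (chart_inv c x) (X (chart_inv c x)))"
  unfolding smooth_field_on_def by (simp add: o_def)

lemma smooth_fun_iff: "smooth_fun M f \<longleftrightarrow> smooth_fun_on M UNIV f"
  unfolding smooth_fun_def smooth_fun_on_def by simp

lemma smooth_field_iff: "smooth_field M X \<longleftrightarrow> smooth_field_on M UNIV X"
  unfolding smooth_field_def smooth_field_on_def by simp

locale smooth_mfd =
  fixes M :: "('m::{t2_space,second_countable_topology}, 'a::euclidean_space) chart set"
  assumes smooth_structure: "smooth_structure M"
begin

lemma is_chart: "c \<in> M \<Longrightarrow> is_chart c"
  using smooth_structure unfolding smooth_structure_def by blast

lemma chart_homeo:
  assumes "c \<in> M"
  obtains \<psi> where "homeomorphism (fst c) (snd c ` fst c) (snd c) \<psi>"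
  using is_chart[OF assms] unfolding is_chart_def by blast

lemma open_chart_dom: "c \<in> M \<Longrightarrow> open (fst c)"
  and open_chart_img: "c \<in> M \<Longrightarrow> open (snd c ` fst c)"
  using is_chart unfolding is_chart_def by blast+

lemma chart_inj:
  assumes "c \<in> M" shows "inj_on (snd c) (fst c)"
proof -
  obtain \<psi> where \<psi>: "homeomorphism (fst c) (snd c ` fst c) (snd c) \<psi>"
    using chart_homeo assms .
  then show ?thesis by (auto intro: inj_on_inverseI homeomorphism_apply1)
qed

lemma chart_inv_left [simp]: "c \<in> M \<Longrightarrow> p \<in> fst c \<Longrightarrow> chart_inv c (snd c p) = p"
  unfolding chart_inv_def using chart_inj by simp

lemma chart_inv_right [simp]: "x \<in> snd c ` fst c \<Longrightarrow> snd c (chart_inv c x) = x"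
  unfolding chart_inv_def by (rule f_inv_into_f)

lemma chart_continuous:
  assumes "c \<in> M" shows "continuous_on (fst c) (snd c)"
  using assms chart_homeo homeomorphism_cont1 by metis

lemma chart_inv_continuous:
  assumes "c \<in> M" shows "continuous_on (snd c ` fst c) (chart_inv c)"
proof -
  obtain \<psi> where \<psi>: "homeomorphism (fst c) (snd c ` fst c) (snd c) \<psi>"
    using chart_homeo assms .
  have "\<psi> x = chart_inv c x" if "x \<in> snd c ` fst c" for x
    using that assms homeomorphism_apply1[OF \<psi>] by auto
  then show ?thesis
    using homeomorphism_cont2[OF \<psi>] continuous_on_cong by metis
qed

lemma open_chart_image:
  assumes c: "c \<in> M" and U: "open U" shows "open (snd c ` (fst c \<inter> U))"
proof -
  have "snd c ` (fst c \<inter> U) = (snd c ` fst c) \<inter> chart_inv c -` U"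
    using c by force
  then show ?thesis
    using continuous_open_preimage[OF chart_inv_continuous[OF c] open_chart_img[OF c] U]
    by (simp add: Int_def)
qed

lemma chart_at: "chart_at M p \<in> M" "p \<in> fst (chart_at M p)"
proof -
  have "\<exists>c. c \<in> M \<and> p \<in> fst c"
    using smooth_structure unfolding smooth_structure_def by blast
  from someI_ex[OF this] show "chart_at M p \<in> M" "p \<in> fst (chart_at M p)"
    unfolding chart_at_def by auto
qed

lemma open_chart_Int: "c \<in> M \<Longrightarrow> open U \<Longrightarrow> open (fst c \<inter> U)"
  using open_chart_dom by blast

lemma transition_smooth:
  "c \<in> M \<Longrightarrow> d \<in> M \<Longrightarrow> smooth_on (snd c ` (fst c \<inter> fst d)) (snd d \<circ> chart_inv c)"
  using smooth_structure unfolding smooth_structure_def chart_compatible_def by blast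

text \<open>One chart around each point suffices, since transition maps are smooth.\<close>

lemma smooth_fun_onI:
  assumes "\<And>p. p \<in> U \<Longrightarrow> \<exists>c\<in>M. \<exists>W. open W \<and> p \<in> W \<and> W \<subseteq> U \<inter> fst c \<and>
    smooth_on (snd c ` W) (f \<circ> chart_inv c)"
  shows "smooth_fun_on M U f"
  unfolding smooth_fun_on_def
proof (intro ballI smooth_on_local)
  fix d x assume d: "d \<in> M" and "x \<in> snd d ` (fst d \<inter> U)"
  then obtain p where p: "p \<in> fst d" "p \<in> U" "x = snd d p" by auto
  obtain c W where c: "c \<in> M" and W0: "open W" "p \<in> W" "W \<subseteq> U \<inter> fst c"
    and sm: "smooth_on (snd c ` W) (f \<circ> chart_inv c)"
    using assms[OF p(2)] by blast
  then have W: "open W" "p \<in> W" "W \<subseteq> U" "W \<subseteq> fst c" by auto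
  let ?T = "snd d ` (fst d \<inter> W)"
  have openT: "open ?T" using open_chart_image d W by blast
  have cW: "fst c \<inter> W = W" using W by blast
  have "smooth_on ?T (snd c \<circ> chart_inv d)"
    using transition_smooth[OF d c] open_chart_image[OF d open_chart_dom[OF c]] openT
    by (rule smooth_on_subset) (use W in auto)
  moreover have "open (snd c ` W)" using open_chart_image[OF c W(1)] cW by simp
  ultimately have "smooth_on ?T (\<lambda>y. (f \<circ> chart_inv c) ((snd c \<circ> chart_inv d) y))"
    using openT d by (intro smooth_on_compose[OF sm]) (auto simp: o_def)
  then have "smooth_on ?T (f \<circ> chart_inv d)"
    by (rule smooth_on_cong[THEN iffD1, OF openT, rotated]) (use c d W in auto)
  then show "\<exists>T. open T \<and> x \<in> T \<and> T \<subseteq> snd d ` (fst d \<inter> U) \<and> smooth_on T (f \<circ> chart_inv d)"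
    using openT p W by (intro exI[of _ ?T]) auto
qed

lemma smooth_fun_onD:
  assumes "smooth_fun_on M U f" "open U" "c \<in> M" "W \<subseteq> fst c \<inter> U" "open W"
  shows "smooth_on (snd c ` W) (f \<circ> chart_inv c)"
proof -
  have "fst c \<inter> W = W" using assms by blast
  then have W: "open (snd c ` W)" using open_chart_image[OF assms(3,5)] by simp
  have "smooth_on (snd c ` (fst c \<inter> U)) (f \<circ> chart_inv c)"
    using assms(1,3) unfolding smooth_fun_on_def by blast
  then show ?thesis
    using open_chart_image[OF assms(3,2)] W by (rule smooth_on_subset) (use assms(4) in blast)
qed

lemma smooth_fun_on_chart:
  assumes "c \<in> M" "open U" shows "smooth_fun_on M (fst c \<inter> U) (snd c)"
proof (rule smooth_fun_onI)
  fix p assume p: "p \<in> fst c \<inter> U"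
  have op: "open (snd c ` (fst c \<inter> U))" using assms open_chart_image by blast
  have "smooth_on (snd c ` (fst c \<inter> U)) (\<lambda>x. x)"
    using op by (intro smooth_on_linear bounded_linear_ident)
  then have "smooth_on (snd c ` (fst c \<inter> U)) (snd c \<circ> chart_inv c)"
    by (rule smooth_on_cong[THEN iffD1, OF op, rotated]) (use assms in auto)
  then show "\<exists>d\<in>M. \<exists>W. open W \<and> p \<in> W \<and> W \<subseteq> fst c \<inter> U \<inter> fst d \<and> smooth_on (snd d ` W) (snd c \<circ> chart_inv d)"
    using p assms open_chart_Int[OF assms] by (intro bexI[of _ c] exI[of _ "fst c \<inter> U"]) auto
qed

lemma smooth_fun_on_subset:
  assumes "smooth_fun_on M U f" "open U" "open V" "V \<subseteq> U"
  shows "smooth_fun_on M V f"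
  unfolding smooth_fun_on_def
proof
  fix c assume "c \<in> M"
  then show "smooth_on (snd c ` (fst c \<inter> V)) (f \<circ> chart_inv c)"
    using assms by (intro smooth_fun_onD[of U] open_chart_Int) auto
qed

lemma smooth_fun_on_cong:
  assumes "smooth_fun_on M U f" "open U" "\<And>p. p \<in> U \<Longrightarrow> f p = g p"
  shows "smooth_fun_on M U g"
  unfolding smooth_fun_on_def
proof
  fix c assume c: "c \<in> M"
  show "smooth_on (snd c ` (fst c \<inter> U)) (g \<circ> chart_inv c)"
    by (rule smooth_on_cong[THEN iffD1, of _ "f \<circ> chart_inv c"])
       (use c assms open_chart_image in \<open>auto simp: smooth_fun_on_def\<close>)
qed

lemma smooth_fun_on_local:
  assumes "\<And>p. p \<in> U \<Longrightarrow> \<exists>V. open V \<and> p \<in> V \<and> V \<subseteq> U \<and> smooth_fun_on M V f"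
  shows "smooth_fun_on M U f"
proof (rule smooth_fun_onI)
  fix p assume "p \<in> U"
  then obtain V where V: "open V" "p \<in> V" "V \<subseteq> U" "smooth_fun_on M V f" using assms by blast
  then show "\<exists>c\<in>M. \<exists>W. open W \<and> p \<in> W \<and> W \<subseteq> U \<inter> fst c \<and> smooth_on (snd c ` W) (f \<circ> chart_inv c)"
    using chart_at[of p] open_chart_Int[OF chart_at(1) V(1)] unfolding smooth_fun_on_def
    by (intro bexI[of _ "chart_at M p"] exI[of _ "fst (chart_at M p) \<inter> V"]) auto
qed

lemma smooth_fun_on_const [simp]: "smooth_fun_on M U (\<lambda>p. k)"
  unfolding smooth_fun_on_def by (simp add: o_def)

lemma smooth_fun_on_bilinear:
  fixes b :: "'b::euclidean_space \<Rightarrow> 'c::euclidean_space \<Rightarrow> 'd::euclidean_space"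
  assumes "bounded_bilinear b" "open U" "smooth_fun_on M U f" "smooth_fun_on M U h"
  shows "smooth_fun_on M U (\<lambda>p. b (f p) (h p))"
  using smooth_on_bilinear[OF assms(1) open_chart_image[OF _ assms(2)] smooth_fun_onE[OF assms(3)] smooth_fun_onE[OF assms(4)]]
  unfolding smooth_fun_on_def o_def by blast

lemmas smooth_fun_on_mult = smooth_fun_on_bilinear[OF bounded_bilinear_mult]
lemmas smooth_fun_on_inner = smooth_fun_on_bilinear[OF bounded_bilinear_inner]

lemma smooth_fun_on_inverse:
  fixes f :: "'m \<Rightarrow> real"
  assumes "open U" "smooth_fun_on M U f" "\<And>p. p \<in> U \<Longrightarrow> f p \<noteq> 0"
  shows "smooth_fun_on M U (\<lambda>p. inverse (f p))"
  unfolding smooth_fun_on_def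
proof
  fix c assume c: "c \<in> M"
  have "smooth_on (snd c ` (fst c \<inter> U)) (\<lambda>x. inverse (f (chart_inv c x)))"
    by (rule smooth_on_inverse[OF open_chart_image[OF c assms(1)] smooth_fun_onE[OF assms(2) c]])
       (use c assms(3) in auto)
  then show "smooth_on (snd c ` (fst c \<inter> U)) ((\<lambda>p. inverse (f p)) \<circ> chart_inv c)"
    by (simp add: o_def)
qed

section \<open>Derivatives of functions in arbitrary charts\<close>

lemma mderiv_cong:
  assumes "open U" "p \<in> U" "\<And>q. q \<in> U \<Longrightarrow> f q = h q"
  shows "mderiv M f p = mderiv M h p"
  unfolding mderiv_def
proof (rule fderiv_cong_open)
  show "open (snd (chart_at M p) ` (fst (chart_at M p) \<inter> U))"
    using open_chart_image chart_at assms by blast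
qed (use assms chart_at in auto)

text \<open>The chain rule through a transition map. It frees all later computations from the
  preferred chart at p: any chart around p computes the same derivative.\<close>

lemma mderiv_chart:
  assumes f: "smooth_fun_on M U f" and U: "open U" "p \<in> U" and c: "c \<in> M" "p \<in> fst c"
  shows "mderiv M f p v = fderiv (f \<circ> chart_inv c) (snd c p) (mderiv M (snd c) p v)"
proof -
  let ?c0 = "chart_at M p"
  let ?S = "snd ?c0 ` (fst ?c0 \<inter> (fst c \<inter> U))"
  have S: "open ?S" "snd ?c0 p \<in> ?S"
    using chart_at[of p] c U by (auto intro!: open_chart_image open_chart_Int)
  have inv: "chart_inv ?c0 (snd ?c0 p) = p" using chart_at by simp
  have "mderiv M f p = fderiv ((f \<circ> chart_inv c) \<circ> (snd c \<circ> chart_inv ?c0)) (snd ?c0 p)"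
    unfolding mderiv_def
    by (rule fderiv_cong_open[OF S]) (use chart_at c in auto)
  also have "\<dots> = fderiv (f \<circ> chart_inv c) ((snd c \<circ> chart_inv ?c0) (snd ?c0 p)) \<circ>
      fderiv (snd c \<circ> chart_inv ?c0) (snd ?c0 p)"
  proof (rule frechet_derivative_compose)
    show "(snd c \<circ> chart_inv ?c0) differentiable at (snd ?c0 p)"
      using transition_smooth[OF chart_at(1)[of p] c(1)]
      by (rule smooth_on_differentiable)
         (use chart_at[of p] c open_chart_image[OF chart_at(1) open_chart_dom[OF c(1)]] in auto)
    show "f \<circ> chart_inv c differentiable at ((snd c \<circ> chart_inv ?c0) (snd ?c0 p))"
      using smooth_fun_onD[OF f U(1) c(1) order_refl]
      by (rule smooth_on_differentiable)
         (use inv c U open_chart_Int[OF c(1) U(1)] open_chart_image[OF c(1) U(1)] in auto)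
  qed
  finally show ?thesis by (simp add: inv mderiv_def)
qed

lemma linear_mderiv:
  assumes f: "smooth_fun_on M U f" and U: "open U" "p \<in> U"
  shows "linear (mderiv M f p)"
  unfolding mderiv_def
proof (rule linear_frechet_derivative)
  show "f \<circ> chart_inv (chart_at M p) differentiable at (snd (chart_at M p) p)"
    using smooth_fun_onD[OF f U(1) chart_at(1)[of p] order_refl]
    by (rule smooth_on_differentiable)
       (use chart_at[of p] U open_chart_Int[OF chart_at(1)] open_chart_image[OF chart_at(1)] in auto)
qed

lemma linear_mderiv_chart: "c \<in> M \<Longrightarrow> p \<in> fst c \<Longrightarrow> linear (mderiv M (snd c) p)"
  using linear_mderiv[OF smooth_fun_on_chart[of c UNIV]] open_chart_dom by simp

lemma mderiv_chart_at [simp]: "mderiv M (snd (chart_at M p)) p v = v"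
proof -
  let ?c = "chart_at M p"
  have "fderiv (snd ?c \<circ> chart_inv ?c) (snd ?c p) = fderiv (\<lambda>x. x) (snd ?c p)"
    by (rule fderiv_cong_open[OF open_chart_img[OF chart_at(1)]]) (use chart_at in auto)
  then show ?thesis unfolding mderiv_def by simp
qed

text \<open>The derivative of the transition map back to the preferred chart is a left inverse,
  because a vector is its own component vector there.\<close>

lemma inj_mderiv_chart:
  assumes c: "c \<in> M" "p \<in> fst c" shows "inj (mderiv M (snd c) p)"
proof (rule inj_on_inverseI)
  let ?d = "chart_at M p"
  show "fderiv (snd ?d \<circ> chart_inv c) (snd c p) (mderiv M (snd c) p v) = v" for v
    using mderiv_chart[OF smooth_fun_on_chart[of ?d UNIV] _ _ c] chart_at open_chart_dom by simp
qed

lemma bij_mderiv_chart: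
  assumes c: "c \<in> M" "p \<in> fst c" shows "bij (mderiv M (snd c) p)"
  using inj_mderiv_chart[OF c] linear_injective_imp_surjective[OF linear_mderiv_chart[OF c]]
  by (simp add: bij_def)

section \<open>Smooth vector fields on open sets\<close>

lemma smooth_field_onI:
  assumes "\<And>p. p \<in> U \<Longrightarrow> \<exists>c\<in>M. \<exists>W. open W \<and> p \<in> W \<and> W \<subseteq> U \<inter> fst c \<and>
    smooth_on (snd c ` W) ((\<lambda>q. mderiv M (snd c) q (X q)) \<circ> chart_inv c)"
  shows "smooth_field_on M U X"
proof -
  have "smooth_fun_on M (fst d \<inter> U) (\<lambda>q. mderiv M (snd d) q (X q))" if d: "d \<in> M" for d
  proof (rule smooth_fun_onI)
    fix p assume p: "p \<in> fst d \<inter> U"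
    then have "p \<in> U" by simp
    from assms[OF this] obtain c W where c: "c \<in> M" and W0: "open W" "p \<in> W" "W \<subseteq> U \<inter> fst c"
      and sm: "smooth_on (snd c ` W) ((\<lambda>q. mderiv M (snd c) q (X q)) \<circ> chart_inv c)"
      by blast
    then have W: "open W" "p \<in> W" "W \<subseteq> U" "W \<subseteq> fst c" by auto
    let ?W = "fst d \<inter> W"
    let ?T = "snd c ` ?W"
    have openW: "open ?W" using open_chart_Int[OF d W(1)] .
    have "fst c \<inter> ?W = ?W" "fst c \<inter> W = W" using W by auto
    then have T: "open ?T" "open (snd c ` W)" using open_chart_image[OF c] openW W by metis+
    have smX: "smooth_on ?T ((\<lambda>q. mderiv M (snd c) q (X q)) \<circ> chart_inv c)"
      using smooth_on_subset[OF sm T(2) T(1)] by auto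
    have id: "smooth_on ?T (\<lambda>x. x)"
      using T by (intro smooth_on_linear bounded_linear_ident)
    \<comment> \<open>The components in d are the components in c, transformed by the derivative of
      the transition map at a varying point.\<close>
    have "smooth_on ?T (\<lambda>x. fderiv (snd d \<circ> chart_inv c) x (((\<lambda>q. mderiv M (snd c) q (X q)) \<circ> chart_inv c) x))"
      by (rule smooth_on_fderiv_apply[OF transition_smooth[OF c d] _ id T(1) _ smX])
         (use c d W open_chart_image open_chart_dom in auto)
    then have "smooth_on ?T ((\<lambda>q. mderiv M (snd d) q (X q)) \<circ> chart_inv c)"
    proof (rule smooth_on_cong[THEN iffD1, OF T(1), rotated])
      fix x assume "x \<in> ?T"
      then obtain q where q: "x = snd c q" "q \<in> fst d" "q \<in> fst c" using W by auto
      then show "fderiv (snd d \<circ> chart_inv c) x (((\<lambda>q. mderiv M (snd c) q (X q)) \<circ> chart_inv c) x) =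
          ((\<lambda>q. mderiv M (snd d) q (X q)) \<circ> chart_inv c) x"
        using mderiv_chart[OF smooth_fun_on_chart[of d UNIV] _ _ c, of q] d c open_chart_dom by simp
    qed
    then show "\<exists>c\<in>M. \<exists>W. open W \<and> p \<in> W \<and> W \<subseteq> fst d \<inter> U \<inter> fst c \<and>
        smooth_on (snd c ` W) ((\<lambda>q. mderiv M (snd d) q (X q)) \<circ> chart_inv c)"
      using c W openW p by (intro bexI[of _ c] exI[of _ ?W]) auto
  qed
  then show ?thesis
    \<comment> \<open>The component function of chart d, which lives on
      \<open>fst d \<inter> U\<close>, is now read in the chart d itself.\<close>
    unfolding smooth_field_on_def smooth_fun_on_def by (metis Int_left_absorb)
qed

lemma smooth_field_onD:
  assumes "smooth_field_on M U X" "open U" "c \<in> M" "W \<subseteq> fst c \<inter> U" "open W"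
  shows "smooth_on (snd c ` W) ((\<lambda>q. mderiv M (snd c) q (X q)) \<circ> chart_inv c)"
proof -
  have "fst c \<inter> W = W" using assms by blast
  then have W: "open (snd c ` W)" using open_chart_image[OF assms(3,5)] by simp
  have "smooth_on (snd c ` (fst c \<inter> U)) ((\<lambda>q. mderiv M (snd c) q (X q)) \<circ> chart_inv c)"
    using assms(1,3) unfolding smooth_field_on_def by blast
  then show ?thesis
    using open_chart_image[OF assms(3,2)] W by (rule smooth_on_subset) (use assms(4) in blast)
qed

lemma smooth_field_on_subset:
  assumes "smooth_field_on M U X" "open U" "open V" "V \<subseteq> U"
  shows "smooth_field_on M V X"
  unfolding smooth_field_on_def
proof
  fix c assume "c \<in> M"
  then show "smooth_on (snd c ` (fst c \<inter> V)) ((\<lambda>q. mderiv M (snd c) q (X q)) \<circ> chart_inv c)"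
    using assms by (intro smooth_field_onD[of U] open_chart_Int) auto
qed

lemma smooth_field_on_cong:
  assumes "smooth_field_on M U X" "open U" "\<And>p. p \<in> U \<Longrightarrow> X p = Y p"
  shows "smooth_field_on M U Y"
  unfolding smooth_field_on_def
proof
  fix c assume c: "c \<in> M"
  show "smooth_on (snd c ` (fst c \<inter> U)) ((\<lambda>q. mderiv M (snd c) q (Y q)) \<circ> chart_inv c)"
    by (rule smooth_on_cong[THEN iffD1, of _ "(\<lambda>q. mderiv M (snd c) q (X q)) \<circ> chart_inv c"])
       (use c assms open_chart_image in \<open>auto simp: smooth_field_on_def\<close>)
qed

lemma smooth_field_on_local:
  assumes "\<And>p. p \<in> U \<Longrightarrow> \<exists>V. open V \<and> p \<in> V \<and> V \<subseteq> U \<and> smooth_field_on M V X"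
  shows "smooth_field_on M U X"
proof (rule smooth_field_onI)
  fix p assume "p \<in> U"
  then obtain V where V: "open V" "p \<in> V" "V \<subseteq> U" "smooth_field_on M V X" using assms by blast
  then show "\<exists>c\<in>M. \<exists>W. open W \<and> p \<in> W \<and> W \<subseteq> U \<inter> fst c \<and>
      smooth_on (snd c ` W) ((\<lambda>q. mderiv M (snd c) q (X q)) \<circ> chart_inv c)"
    using chart_at[of p] open_chart_Int[OF chart_at(1) V(1)] unfolding smooth_field_on_def
    by (intro bexI[of _ "chart_at M p"] exI[of _ "fst (chart_at M p) \<inter> V"]) auto
qed

lemma smooth_field_on_add:
  assumes U: "open U" and X: "smooth_field_on M U X" and Y: "smooth_field_on M U Y"
  shows "smooth_field_on M U (\<lambda>p. X p + Y p)"
  unfolding smooth_field_on_def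
proof
  fix c assume c: "c \<in> M"
  let ?S = "snd c ` (fst c \<inter> U)"
  have S: "open ?S" using open_chart_image c U by blast
  have "smooth_on ?S (\<lambda>x. ((\<lambda>q. mderiv M (snd c) q (X q)) \<circ> chart_inv c) x +
      ((\<lambda>q. mderiv M (snd c) q (Y q)) \<circ> chart_inv c) x)"
    using smooth_on_add[OF S smooth_field_onE[OF X c] smooth_field_onE[OF Y c]] by simp
  then show "smooth_on ?S ((\<lambda>q. mderiv M (snd c) q (X q + Y q)) \<circ> chart_inv c)"
    by (rule smooth_on_cong[THEN iffD1, OF S, rotated])
       (use c linear_add[OF linear_mderiv_chart[OF c]] in auto)
qed

lemma smooth_field_on_scaleR:
  assumes U: "open U" and f: "smooth_fun_on M U f" and X: "smooth_field_on M U X"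
  shows "smooth_field_on M U (\<lambda>p. f p *\<^sub>R X p)"
  unfolding smooth_field_on_def
proof
  fix c assume c: "c \<in> M"
  let ?S = "snd c ` (fst c \<inter> U)"
  have S: "open ?S" using open_chart_image c U by blast
  have "smooth_on ?S (\<lambda>x. (f \<circ> chart_inv c) x *\<^sub>R ((\<lambda>q. mderiv M (snd c) q (X q)) \<circ> chart_inv c) x)"
    using smooth_on_scaleR[OF S smooth_fun_onE[OF f c] smooth_field_onE[OF X c]] by simp
  then show "smooth_on ?S ((\<lambda>q. mderiv M (snd c) q (f q *\<^sub>R X q)) \<circ> chart_inv c)"
    by (rule smooth_on_cong[THEN iffD1, OF S, rotated])
       (use c linear_scale[OF linear_mderiv_chart[OF c]] in auto)
qed

lemma smooth_field_on_zero:
  assumes "open U" shows "smooth_field_on M U (\<lambda>p. 0)"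
  unfolding smooth_field_on_def
proof
  fix c assume c: "c \<in> M"
  show "smooth_on (snd c ` (fst c \<inter> U)) ((\<lambda>q. mderiv M (snd c) q 0) \<circ> chart_inv c)"
    by (rule smooth_on_cong[THEN iffD1, of _ "\<lambda>_. 0"])
       (use c open_chart_image[OF c assms] linear_0[OF linear_mderiv_chart[OF c]] in auto)
qed

lemma smooth_field_add: "smooth_field M X \<Longrightarrow> smooth_field M Y \<Longrightarrow> smooth_field M (\<lambda>p. X p + Y p)"
  unfolding smooth_field_iff by (rule smooth_field_on_add) auto

lemma smooth_field_scaleR: "smooth_fun M f \<Longrightarrow> smooth_field M X \<Longrightarrow> smooth_field M (\<lambda>p. f p *\<^sub>R X p)"
  unfolding smooth_field_iff smooth_fun_iff by (rule smooth_field_on_scaleR) auto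

lemma smooth_fun_const [simp]: "smooth_fun M (\<lambda>p. k)"
  unfolding smooth_fun_iff by simp

lemma smooth_field_minus: "smooth_field M X \<Longrightarrow> smooth_field M (\<lambda>p. - X p)"
  using smooth_field_scaleR[of "\<lambda>_. -1" X] by simp

lemma smooth_fun_on_mderiv_apply:
  assumes U: "open U" and f: "smooth_fun_on M U f" and X: "smooth_field_on M U X"
  shows "smooth_fun_on M U (\<lambda>q. mderiv M f q (X q))"
proof (rule smooth_fun_onI)
  fix p assume p: "p \<in> U"
  let ?c = "chart_at M p"
  let ?W = "fst ?c \<inter> U"
  let ?T = "snd ?c ` ?W"
  have W: "open ?W" using open_chart_Int[OF chart_at(1) U] .
  have T: "open ?T" using open_chart_image[OF chart_at(1) U] .
  have id: "smooth_on ?T (\<lambda>x. x)"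
    using T by (intro smooth_on_linear bounded_linear_ident)
  have "smooth_on ?T (\<lambda>x. fderiv (f \<circ> chart_inv ?c) x (((\<lambda>q. mderiv M (snd ?c) q (X q)) \<circ> chart_inv ?c) x))"
    using smooth_on_fderiv_apply[OF smooth_fun_onE[OF f chart_at(1)] T id T _ smooth_field_onE[OF X chart_at(1)]]
    by (simp add: o_def)
  then have "smooth_on ?T ((\<lambda>q. mderiv M f q (X q)) \<circ> chart_inv ?c)"
    by (rule smooth_on_cong[THEN iffD1, OF T, rotated])
       (use chart_at(1)[of p] mderiv_chart[OF f U _ chart_at(1)] in auto)
  then show "\<exists>c\<in>M. \<exists>W. open W \<and> p \<in> W \<and> W \<subseteq> U \<inter> fst c \<and> smooth_on (snd c ` W) ((\<lambda>q. mderiv M f q (X q)) \<circ> chart_inv c)"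
    using chart_at[of p] p W by (intro bexI[of _ ?c] exI[of _ ?W]) auto
qed

text \<open>The bracket is the commutator of derivations: the second-order terms of X(Yf) and Y(Xf)
  cancel by \<open>fderiv_commute\<close>. Taking f to be a chart computes the bracket in any
  coordinates; taking f to be the coordinates of \<pi> shows that vertical fields are closed under
  it.\<close>

lemma mderiv_lie_bracket:
  assumes f: "smooth_fun_on M U f" and X: "smooth_field_on M U X" and Y: "smooth_field_on M U Y"
    and U: "open U" "p \<in> U"
  shows "mderiv M f p (lie_bracket M X Y p) =
    mderiv M (\<lambda>q. mderiv M f q (Y q)) p (X p) - mderiv M (\<lambda>q. mderiv M f q (X q)) p (Y p)"
proof -
  let ?c = "chart_at M p"
  define x where "x = snd ?c p"
  define S where "S = snd ?c ` (fst ?c \<inter> U)"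
  define F where "F = f \<circ> chart_inv ?c"
  define co where "co X = (\<lambda>q. mderiv M (snd ?c) q (X q)) \<circ> chart_inv ?c" for X
  have S: "open S" "x \<in> S"
    unfolding S_def x_def using open_chart_image[OF chart_at(1) U(1)] chart_at U by auto
  have smF: "smooth_on S F"
    using f chart_at(1) unfolding smooth_fun_on_def S_def F_def by blast
  have sm: "smooth_on S (co X)" "smooth_on S (co Y)"
    using X Y chart_at(1) unfolding smooth_field_on_def S_def co_def by blast+
  have cox: "co X x = X p" for X
    unfolding co_def x_def using chart_at[of p] by simp
  have md: "mderiv M h p v = fderiv (h \<circ> chart_inv ?c) x v" for h :: "'m \<Rightarrow> 'z::euclidean_space" and v
    by (simp add: mderiv_def x_def)
  have br: "lie_bracket M X Y p = fderiv (co Y) x (X p) - fderiv (co X) x (Y p)"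
    unfolding lie_bracket_def Let_def md co_def ..
  have D: "mderiv M (\<lambda>q. mderiv M f q (Z q)) p v =
      fderiv (\<lambda>y. fderiv F y (Z p)) x v + fderiv F x (fderiv (co Z) x v)"
    if Z: "smooth_on S (co Z)" for Z v
  proof -
    have "mderiv M (\<lambda>q. mderiv M f q (Z q)) p v = fderiv (\<lambda>y. fderiv F y (co Z y)) x v"
      unfolding md
      by (rule arg_cong[where f="\<lambda>f. f v"], rule fderiv_cong_open[OF S])
         (use mderiv_chart[OF f U(1) _ chart_at(1)] chart_at[of p] in \<open>auto simp: S_def F_def co_def o_def\<close>)
    then show ?thesis
      using fderiv_fderiv_apply[OF smF Z S] cox by simp
  qed
  have lin: "linear (fderiv F x)"
    using smooth_on_differentiable[OF smF S] by (rule linear_frechet_derivative)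
  have "mderiv M f p (lie_bracket M X Y p) = fderiv F x (fderiv (co Y) x (X p)) - fderiv F x (fderiv (co X) x (Y p))"
    unfolding md[of f] br F_def[symmetric] using linear_diff[OF lin] by simp
  then show ?thesis
    unfolding D[OF sm(1)] D[OF sm(2)] using fderiv_commute[OF smF S, of "X p" "Y p"] by simp
qed

text \<open>The Euclidean bump is transported by a chart and extended by 0. The two descriptions
  agree on the overlap of the chart domain with the complement of K, and these open sets cover the
  manifold.\<close>

lemma bump_fun:
  assumes U: "open U" "p \<in> U"
  obtains \<beta> K where "smooth_fun M \<beta>" "\<beta> p = (1::real)" "closed K" "K \<subseteq> U" "\<And>q. q \<notin> K \<Longrightarrow> \<beta> q = 0"
proof -
  let ?c = "chart_at M p"
  let ?S = "snd ?c ` (fst ?c \<inter> U)"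
  have S: "open ?S" "snd ?c p \<in> ?S"
    using open_chart_image[OF chart_at(1) U(1)] chart_at U by auto
  then obtain r where r: "r > 0" "cball (snd ?c p) r \<subseteq> ?S"
    using open_contains_cball by blast
  obtain b :: "'a \<Rightarrow> real" where b: "smooth_on UNIV b" "b (snd ?c p) = 1"
    "\<And>y. y \<notin> cball (snd ?c p) r \<Longrightarrow> b y = 0"
    using smooth_bump[OF r(1)] by blast
  define K where "K = chart_inv ?c ` cball (snd ?c p) r"
  define \<beta> where "\<beta> q = (if q \<in> fst ?c then b (snd ?c q) else 0)" for q
  have KU: "K \<subseteq> fst ?c \<inter> U"
    using r(2) chart_at[of p] unfolding K_def by fastforce
  have "compact K"
    unfolding K_def
    using r(2) by (intro compact_continuous_image continuous_on_subset[OF chart_inv_continuous[OF chart_at(1)]]) auto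
  \<comment> \<open>Here the Hausdorff property enters: K is compact as the image of a closed ball,
    hence closed in the whole manifold and not just in the chart domain.\<close>
  then have K: "closed K" by (rule compact_imp_closed)
  have 0: "\<beta> q = 0" if "q \<notin> K" for q
  proof (cases "q \<in> fst ?c")
    case True
    then have "q = chart_inv ?c (snd ?c q)" using chart_at by simp
    then have "snd ?c q \<notin> cball (snd ?c p) r" using that unfolding K_def by blast
    then show ?thesis using b(3) by (simp add: \<beta>_def)
  qed (simp add: \<beta>_def)
  have "smooth_fun_on M UNIV \<beta>"
  proof (rule smooth_fun_on_local)
    fix q :: 'm
    show "\<exists>V. open V \<and> q \<in> V \<and> V \<subseteq> UNIV \<and> smooth_fun_on M V \<beta>"
    proof (cases "q \<in> fst ?c")
      case True
      have o: "open (fst ?c)" using chart_at open_chart_dom by blast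
      have "smooth_fun_on M (fst ?c) (\<lambda>q. b (snd ?c q))"
      proof -
        have "smooth_fun_on M (fst ?c) (snd ?c)"
          using smooth_fun_on_chart[OF chart_at(1)[of p] open_UNIV] by simp
        then have "smooth_on (snd d ` (fst d \<inter> fst ?c)) (\<lambda>x. b (snd ?c (chart_inv d x)))" if "d \<in> M" for d
          using smooth_on_compose[OF b(1) smooth_fun_onE open_UNIV open_chart_image[OF that o]] that by blast
        then show ?thesis unfolding smooth_fun_on_def by (simp add: o_def)
      qed
      then have "smooth_fun_on M (fst ?c) \<beta>"
        by (rule smooth_fun_on_cong[OF _ o]) (simp add: \<beta>_def)
      then show ?thesis using o True by blast
    next
      case False
      then have "q \<in> - K" using KU by blast
      moreover have "smooth_fun_on M (- K) \<beta>"
        by (rule smooth_fun_on_cong[of _ "\<lambda>_. 0"]) (use K 0 in auto)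
      ultimately show ?thesis using K by blast
    qed
  qed
  then show thesis
    using that[of \<beta> K] K KU 0 b(2) chart_at[of p] by (auto simp: smooth_fun_iff \<beta>_def)
qed

text \<open>The last property, that Y is pointwise a multiple of X, makes the extension stay in
  every field of subspaces to which X belongs.\<close>

lemma extend_field:
  assumes U: "open U" "p \<in> U" and X: "smooth_field_on M U X"
  obtains Y where "smooth_field M Y" "Y p = X p" "\<And>q. q \<notin> U \<Longrightarrow> Y q = 0" "\<And>q. \<exists>r. Y q = r *\<^sub>R X q"
proof -
  obtain \<beta> K where \<beta>: "smooth_fun M \<beta>" "\<beta> p = (1::real)" "closed K" "K \<subseteq> U" "\<And>q. q \<notin> K \<Longrightarrow> \<beta> q = 0"
    using bump_fun[OF U] by blast
  have "smooth_field_on M UNIV (\<lambda>q. \<beta> q *\<^sub>R X q)"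
  proof (rule smooth_field_on_local)
    fix q :: 'm
    show "\<exists>V. open V \<and> q \<in> V \<and> V \<subseteq> UNIV \<and> smooth_field_on M V (\<lambda>q. \<beta> q *\<^sub>R X q)"
    proof (cases "q \<in> U")
      case True
      have "smooth_fun_on M U \<beta>"
        using \<beta>(1) smooth_fun_on_subset U unfolding smooth_fun_iff by blast
      then have "smooth_field_on M U (\<lambda>q. \<beta> q *\<^sub>R X q)"
        using X U by (intro smooth_field_on_scaleR)
      then show ?thesis using U True by blast
    next
      case False
      then have q: "q \<in> - K" using \<beta>(4) by blast
      have 0: "smooth_field_on M (- K) (\<lambda>_. 0)"
        using \<beta>(3) by (intro smooth_field_on_zero) auto
      have "smooth_field_on M (- K) (\<lambda>q. \<beta> q *\<^sub>R X q)"
        by (rule smooth_field_on_cong[OF 0]) (use \<beta> in auto)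
      then show ?thesis using q \<beta>(3) by blast
    qed
  qed
  then show thesis
    using that[of "\<lambda>q. \<beta> q *\<^sub>R X q"] \<beta> unfolding smooth_field_iff by auto
qed

end

subsection \<open>Orthogonal projections\<close>

locale pos_form =
  fixes G :: "'a::euclidean_space \<Rightarrow> 'a \<Rightarrow> real"
  assumes bilin: "bilinear G" and sym: "G u v = G v u" and pos: "v \<noteq> 0 \<Longrightarrow> G v v > 0"
begin

lemmas add_left = bilinear_ladd[OF bilin] and add_right = bilinear_radd[OF bilin]
  and diff_left = bilinear_lsub[OF bilin] and diff_right = bilinear_rsub[OF bilin]
  and minus_left = bilinear_lneg[OF bilin] and minus_right = bilinear_rneg[OF bilin]
  and scale_left = bilinear_lmul[OF bilin] and scale_right = bilinear_rmul[OF bilin]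
  and zero_left [simp] = bilinear_lzero[OF bilin] and zero_right [simp] = bilinear_rzero[OF bilin]

lemmas expand = add_left add_right diff_left diff_right minus_left minus_right scale_left scale_right

lemma self_eq_0_iff [simp]: "G v v = 0 \<longleftrightarrow> v = 0"
  using pos[of v] by (cases "v = 0") auto

lemma subspace_orth_compl: "subspace (orth_compl G S)"
  by (simp add: subspace_def orth_compl_def expand)

text \<open>One Gram-Schmidt step per vector: the new b is replaced by its part ?b' orthogonal to
  span B, and the old projection of v is corrected by the component of v along ?b'.\<close>

lemma projection_span:
  assumes "finite B" shows "\<exists>u\<in>span B. \<forall>w\<in>span B. G (v - u) w = 0"
  using assms
proof (induction B arbitrary: v rule: finite_induct)
  case empty
  then show ?case by simp
next
  case (insert b B)
  obtain b\<^sub>1 where b\<^sub>1: "b\<^sub>1 \<in> span B" "\<And>w. w \<in> span B \<Longrightarrow> G (b - b\<^sub>1) w = 0"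
    using insert.IH[of b] by blast
  obtain u where u: "u \<in> span B" "\<And>w. w \<in> span B \<Longrightarrow> G (v - u) w = 0"
    using insert.IH[of v] by blast
  let ?b' = "b - b\<^sub>1"
  let ?u' = "u + (G v ?b' / G ?b' ?b') *\<^sub>R ?b'"
  have span_mono': "w \<in> span B \<Longrightarrow> w \<in> span (insert b B)" for w
    using span_mono[of B "insert b B"] by blast
  have b': "?b' \<in> span (insert b B)"
    using span_diff[OF span_base span_mono'[OF b\<^sub>1(1)]] by auto
  have u': "?u' \<in> span (insert b B)"
    using span_mono'[OF u(1)] b' by (intro span_add span_scale)
  have ub: "G u ?b' = 0" using b\<^sub>1(2)[OF u(1)] sym by metis
  have 1: "G (v - ?u') w = 0" if "w \<in> span B" for w
    using u(2)[OF that] b\<^sub>1(2)[OF that] by (simp add: expand)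
  have 2: "G (v - ?u') ?b' = 0"
  proof (cases "?b' = 0")
    \<comment> \<open>Here b already lies in span B; the correction term is a multiple of ?b' =
      0.\<close>
    case True
    then show ?thesis by simp
  next
    case False
    then have "G ?b' ?b' \<noteq> 0" by simp
    then have "(G v ?b' / G ?b' ?b') * G ?b' ?b' = G v ?b'" by simp
    moreover have "G (v - ?u') ?b' = G v ?b' - G u ?b' - (G v ?b' / G ?b' ?b') * G ?b' ?b'"
      by (simp add: diff_left add_left scale_left del: times_divide_eq_left)
    ultimately show ?thesis using ub by simp
  qed
  have "G (v - ?u') w = 0" if w: "w \<in> span (insert b B)" for w
  proof -
    obtain k where k: "w - k *\<^sub>R b \<in> span B" using w span_breakdown_eq[of w b B] by blast
    have "G (v - ?u') w = G (v - ?u') ((w - k *\<^sub>R b) + k *\<^sub>R b\<^sub>1 + k *\<^sub>R ?b')"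
      by (simp add: algebra_simps)
    also have "\<dots> = G (v - ?u') (w - k *\<^sub>R b) + k * G (v - ?u') b\<^sub>1 + k * G (v - ?u') ?b'"
      unfolding add_right[of "v - ?u'"] scale_right[of "v - ?u'"] by simp
    finally have "G (v - ?u') w = G (v - ?u') (w - k *\<^sub>R b) + k * G (v - ?u') b\<^sub>1 + k * G (v - ?u') ?b'" .
    then show ?thesis using 1[OF k] 1[OF b\<^sub>1(1)] 2 by simp
  qed
  then show ?case using u' by blast
qed

text \<open>Two candidates differ by a vector of S that is orthogonal to itself, so positivity makes
  the description unique.\<close>

lemma orth_proj_eqI:
  assumes "subspace S" "u \<in> S" "v - u \<in> orth_compl G S" shows "orth_proj G S v = u"
  unfolding orth_proj_def
proof (rule the_equality)
  fix u' assume u': "u' \<in> S \<and> v - u' \<in> orth_compl G S"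
  then have d: "u' - u \<in> S" using assms by (simp add: subspace_diff)
  have "G (v - u) (u' - u) = 0" "G (v - u') (u' - u) = 0"
    using u' assms d unfolding orth_compl_def by auto
  then have "G (u' - u) (u' - u) = 0" by (simp add: expand)
  then show "u' = u" by simp
qed (use assms in auto)

lemma orth_proj:
  assumes S: "subspace S"
  shows "orth_proj G S v \<in> S" "v - orth_proj G S v \<in> orth_compl G S"
proof -
  obtain B where "B \<subseteq> S" "finite B" "S = span B"
    using basis_exists[of S] S independent_imp_finite span_minimal by (metis subset_antisym)
  then obtain u where u: "u \<in> S" "\<forall>w\<in>S. G (v - u) w = 0" using projection_span by metis
  then have "v - u \<in> orth_compl G S" unfolding orth_compl_def by blast
  then show "orth_proj G S v \<in> S" "v - orth_proj G S v \<in> orth_compl G S"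
    using orth_proj_eqI[OF S u(1)] u(1) by simp_all
qed

lemma orth_proj_in: "subspace S \<Longrightarrow> v \<in> S \<Longrightarrow> orth_proj G S v = v"
  by (rule orth_proj_eqI) (auto simp: orth_compl_def)

lemma orth_proj_orth: "subspace S \<Longrightarrow> v \<in> orth_compl G S \<Longrightarrow> orth_proj G S v = 0"
  by (rule orth_proj_eqI) (auto simp: subspace_0)

text \<open>For v in the double complement, v minus its projection to S is orthogonal both to v and
  to the projection, hence to itself.\<close>

lemma orth_compl_orth_compl:
  assumes S: "subspace S" shows "orth_compl G (orth_compl G S) = S"
proof
  show "S \<subseteq> orth_compl G (orth_compl G S)"
    unfolding orth_compl_def using sym by auto
  show "orth_compl G (orth_compl G S) \<subseteq> S"
  proof
    fix v assume v: "v \<in> orth_compl G (orth_compl G S)"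
    let ?w = "v - orth_proj G S v"
    have w: "?w \<in> orth_compl G S" using orth_proj[OF S] by blast
    have "G v ?w = 0" using v w unfolding orth_compl_def by blast
    moreover have "G ?w (orth_proj G S v) = 0" using w orth_proj(1)[OF S] unfolding orth_compl_def by blast
    ultimately have "G ?w ?w = 0" using sym[of ?w "orth_proj G S v"] by (simp add: expand)
    then have "v = orth_proj G S v" by simp
    then show "v \<in> S" using orth_proj(1)[OF S] by metis
  qed
qed

lemma inner_orth_proj:
  assumes "subspace S" "w \<in> S" shows "G (orth_proj G S v) w = G v w"
proof -
  have "G (v - orth_proj G S v) w = 0"
    using orth_proj(2)[OF assms(1)] assms(2) unfolding orth_compl_def by blast
  then show ?thesis by (simp add: expand)
qed

end

subsection \<open>Kernels and complex structures\<close>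

context smooth_mfd
begin

lemma mderiv_compose:
  fixes h :: "'c::euclidean_space \<Rightarrow> 'd::euclidean_space"
  assumes f: "smooth_fun_on M U f" and U: "open U" "p \<in> U"
    and h: "h differentiable (at (f p))"
  shows "mderiv M (\<lambda>q. h (f q)) p v = fderiv h (f p) (mderiv M f p v)"
proof -
  let ?c = "chart_at M p"
  have "smooth_on (snd ?c ` (fst ?c \<inter> U)) (f \<circ> chart_inv ?c)"
    using f chart_at(1) unfolding smooth_fun_on_def by blast
  then have "f \<circ> chart_inv ?c differentiable at (snd ?c p)"
    by (rule smooth_on_differentiable) (use chart_at[of p] U open_chart_image[OF chart_at(1)] in auto)
  from frechet_derivative_compose[OF this, of h] h show ?thesis
    unfolding mderiv_def using chart_at[of p] by (simp add: o_def)
qed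

lemma mderiv_linear_compose:
  fixes L :: "'c::euclidean_space \<Rightarrow> 'd::euclidean_space"
  assumes "linear L" "smooth_fun_on M U f" "open U" "p \<in> U"
  shows "mderiv M (\<lambda>q. L (f q)) p v = L (mderiv M f p v)"
proof -
  have "(L has_derivative L) (at (f p))"
    using assms(1) by (intro bounded_linear_imp_has_derivative) (simp add: linear_conv_bounded_linear)
  then show ?thesis
    using mderiv_compose[OF assms(2-4), of L] frechet_derivative_at[of L L] by (auto simp: differentiable_def)
qed

lemma mderiv_const [simp]: "mderiv M (\<lambda>q. k) p v = 0"
  unfolding mderiv_def by (simp add: o_def)

text \<open>The field with constant components in c. The tangent spaces are identified with the
  model through preferred charts, so the constant has to be pulled back at each q by the inverse of
  the derivative of c.\<close>

lemma coordinate_field: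
  assumes c: "c \<in> M" "p \<in> fst c"
  obtains X where "smooth_field_on M (fst c) X" "X p = v"
proof -
  let ?X = "\<lambda>q. inv (mderiv M (snd c) q) (mderiv M (snd c) p v)"
  have "mderiv M (snd c) q (?X q) = mderiv M (snd c) p v" if "q \<in> fst c" for q
    using bij_mderiv_chart[OF c(1) that] by (simp add: bij_is_surj surj_f_inv_f)
  then have "smooth_on (snd c ` fst c) ((\<lambda>q. mderiv M (snd c) q (?X q)) \<circ> chart_inv c)"
    by (intro smooth_on_cong[THEN iffD1, OF open_chart_img[OF c(1)] _ smooth_on_const]) (use c in auto)
  then have "smooth_field_on M (fst c) ?X"
    using c(1) open_chart_dom[OF c(1)] by (intro smooth_field_onI) blast
  moreover have "?X p = v" using inj_mderiv_chart[OF c] by simp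
  ultimately show thesis using that by blast
qed

text \<open>Gaussian elimination without division: if \<open>V\<^sub>0\<close> and \<open>R\<close> solve all equations but the last
  one, \<open>l\<close>, then \<open>l(R) V\<^sub>0 - l(V\<^sub>0) R\<close> solves all of them.\<close>

lemma local_kernel_field:
  fixes f :: "'m \<Rightarrow> 'b::euclidean_space"
  assumes c: "c \<in> M" and U: "open U" "U \<subseteq> fst c" "p \<in> U" and f: "smooth_fun_on M U f"
    and onto: "surj (mderiv M f p)" and S: "finite S" "S \<subseteq> Basis"
    and v: "\<And>b. b \<in> S \<Longrightarrow> mderiv M f p v \<bullet> b = 0"
  shows "\<exists>X. smooth_field_on M U X \<and> X p = v \<and> (\<forall>q\<in>U. \<forall>b\<in>S. mderiv M f q (X q) \<bullet> b = 0)"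
  using S v
proof (induction S arbitrary: v rule: finite_induct)
  case empty
  obtain X where "smooth_field_on M (fst c) X" "X p = v"
    using coordinate_field c U by blast
  then show ?case
    using smooth_field_on_subset open_chart_dom[OF c] U by auto
next
  case (insert b S)
  \<comment> \<open>Surjectivity supplies r with image b; as distinct basis vectors are orthogonal,
    r satisfies all the equations in S, so the induction hypothesis extends r as well as v.\<close>
  obtain r where r: "mderiv M f p r = b" using onto by (metis surjD)
  have "mderiv M f p r \<bullet> b' = 0" if "b' \<in> S" for b'
  proof -
    have "b \<noteq> b'" using that insert.hyps by blast
    then show ?thesis using that insert.prems r inner_not_same_Basis[of b b'] by auto
  qed
  then obtain R where R: "smooth_field_on M U R" "R p = r" "\<forall>q\<in>U. \<forall>b\<in>S. mderiv M f q (R q) \<bullet> b = 0"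
    using insert by blast
  obtain V where V: "smooth_field_on M U V" "V p = v" "\<forall>q\<in>U. \<forall>b\<in>S. mderiv M f q (V q) \<bullet> b = 0"
    using insert.IH[of v] insert.prems by auto
  define l where "l X q = mderiv M f q (X q) \<bullet> b" for X q
  have sml: "smooth_fun_on M U (l X)" if "smooth_field_on M U X" for X
    unfolding l_def using smooth_fun_on_mderiv_apply[OF U(1) f that] U
    by (intro smooth_fun_on_inner) auto
  define X where "X q = l R q *\<^sub>R V q + ((-1) * l V q) *\<^sub>R R q" for q
  have "smooth_field_on M U X"
    unfolding X_def using U sml[OF R(1)] sml[OF V(1)] R(1) V(1)
    by (intro smooth_field_on_add smooth_field_on_scaleR smooth_fun_on_mult) auto
  \<comment> \<open>At p the coefficients are \<open>l R p\<close> = 1, by the choice of r, and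
    \<open>l V p\<close> = 0, since v solves the equation of b there.\<close>
  moreover have "X p = v"
    using insert R V r unfolding X_def l_def by simp
  moreover have "mderiv M f q (X q) \<bullet> b' = 0" if q: "q \<in> U" and b': "b' \<in> insert b S" for q b'
  proof -
    have lin: "linear (mderiv M f q)" using linear_mderiv[OF f U(1) q] .
    have "mderiv M f q (X q) \<bullet> b' = l R q * (mderiv M f q (V q) \<bullet> b') - l V q * (mderiv M f q (R q) \<bullet> b')"
      unfolding X_def by (simp add: linear_add[OF lin] linear_scale[OF lin] linear_diff[OF lin] linear_neg[OF lin] inner_add_left inner_diff_left)
    then show ?thesis using R(3) V(3) q b' unfolding l_def by auto
  qed
  ultimately show ?case by blast
qed

definition constant_in_chart :: "('m \<Rightarrow> 'a \<Rightarrow> 'a) \<Rightarrow> ('m, 'a) chart \<Rightarrow> ('a \<Rightarrow> 'a) \<Rightarrow> bool" where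
  "constant_in_chart J c J\<^sub>0 \<longleftrightarrow> linear J\<^sub>0 \<and>
     (\<forall>q\<in>fst c. \<forall>v. mderiv M (snd c) q (J q v) = J\<^sub>0 (mderiv M (snd c) q v))"

lemma complex_chart:
  assumes "complex_structure M J"
  obtains c J\<^sub>0 where "c \<in> M" "p \<in> fst c" "constant_in_chart J c J\<^sub>0"
  using assms unfolding complex_structure_def constant_in_chart_def[symmetric] by blast

lemma smooth_complex_structure:
  assumes J: "complex_structure M J" and X: "smooth_field M X"
  shows "smooth_field M (apply_field J X)"
  unfolding smooth_field_iff
proof (rule smooth_field_onI)
  fix p :: 'm
  obtain c J\<^sub>0 where c: "c \<in> M" "p \<in> fst c" and J\<^sub>0: "constant_in_chart J c J\<^sub>0"
    using complex_chart[OF J] .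
  note J\<^sub>0 = conjunct1[OF J\<^sub>0[unfolded constant_in_chart_def]]
    bspec[OF conjunct2[OF J\<^sub>0[unfolded constant_in_chart_def]], THEN spec]
  have o: "open (snd c ` fst c)" using open_chart_img c by blast
  have "smooth_on UNIV J\<^sub>0"
    using J\<^sub>0(1) by (intro smooth_on_linear) (simp_all add: linear_conv_bounded_linear)
  moreover have "smooth_on (snd c ` fst c) (\<lambda>x. mderiv M (snd c) (chart_inv c x) (X (chart_inv c x)))"
    using smooth_field_onE[OF X[unfolded smooth_field_iff] c(1)] by simp
  ultimately have "smooth_on (snd c ` fst c) (\<lambda>x. J\<^sub>0 (mderiv M (snd c) (chart_inv c x) (X (chart_inv c x))))"
    using open_UNIV o by (rule smooth_on_compose) simp
  then have "smooth_on (snd c ` fst c) ((\<lambda>q. mderiv M (snd c) q (apply_field J X q)) \<circ> chart_inv c)"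
  proof (rule smooth_on_cong[THEN iffD1, OF o, rotated])
    fix x assume "x \<in> snd c ` fst c"
    then have "chart_inv c x \<in> fst c" using c(1) by auto
    then show "J\<^sub>0 (mderiv M (snd c) (chart_inv c x) (X (chart_inv c x))) =
        ((\<lambda>q. mderiv M (snd c) q (apply_field J X q)) \<circ> chart_inv c) x"
      using J\<^sub>0(2) by (simp add: apply_field_def)
  qed
  then show "\<exists>c\<in>M. \<exists>W. open W \<and> p \<in> W \<and> W \<subseteq> UNIV \<inter> fst c \<and>
      smooth_on (snd c ` W) ((\<lambda>q. mderiv M (snd c) q (apply_field J X q)) \<circ> chart_inv c)"
    using c open_chart_dom[OF c(1)] by blast
qed

lemma nijenhuis_vanishes:
  assumes J: "complex_structure M J" and X: "smooth_field M X" and Y: "smooth_field M Y"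
  shows "lie_bracket M (apply_field J X) (apply_field J Y) p - J p (lie_bracket M (apply_field J X) Y p)
    - J p (lie_bracket M X (apply_field J Y) p) - lie_bracket M X Y p = 0" (is "?N = 0")
proof -
  obtain c J\<^sub>0 where c: "c \<in> M" "p \<in> fst c" and J\<^sub>0: "constant_in_chart J c J\<^sub>0"
    using complex_chart[OF J] .
  note J\<^sub>0 = conjunct1[OF J\<^sub>0[unfolded constant_in_chart_def]]
    bspec[OF conjunct2[OF J\<^sub>0[unfolded constant_in_chart_def]], THEN spec]
  let ?m = "mderiv M (snd c)"
  note [simp] = linear_add[OF J\<^sub>0(1)] linear_diff[OF J\<^sub>0(1)] linear_neg[OF J\<^sub>0(1)]
  have o: "open (fst c)" using open_chart_dom c by blast
  have smc: "smooth_fun_on M (fst c) (snd c)" using smooth_fun_on_chart[OF c(1) open_UNIV] by simp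
  have lin: "linear (?m p)" using linear_mderiv_chart[OF c] .
  have J\<^sub>02: "J\<^sub>0 (J\<^sub>0 w) = - w" for w
  proof -
    obtain v where "w = ?m p v" using bij_mderiv_chart[OF c] by (metis bij_pointE)
    moreover have "J p (J p v) = - v" using J unfolding complex_structure_def by blast
    ultimately show ?thesis using J\<^sub>0(2)[OF c(2)] linear_neg[OF lin] by metis
  qed
  have on: "smooth_field_on M (fst c) Z" if "smooth_field M Z" for Z
    using that o smooth_field_on_subset unfolding smooth_field_iff by blast
  have br: "?m p (lie_bracket M Z Z' p) = mderiv M (\<lambda>q. ?m q (Z' q)) p (Z p) - mderiv M (\<lambda>q. ?m q (Z q)) p (Z' p)"
    if "smooth_field M Z" "smooth_field M Z'" for Z Z'
    using mderiv_lie_bracket[OF smc on[OF that(1)] on[OF that(2)] o c(2)] .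
  have dJ: "mderiv M (\<lambda>q. ?m q (apply_field J Z q)) p v = J\<^sub>0 (mderiv M (\<lambda>q. ?m q (Z q)) p v)"
    if "smooth_field M Z" for Z v
  proof -
    have "mderiv M (\<lambda>q. ?m q (apply_field J Z q)) p v = mderiv M (\<lambda>q. J\<^sub>0 (?m q (Z q))) p v"
      using mderiv_cong[OF o c(2), of "\<lambda>q. ?m q (apply_field J Z q)" "\<lambda>q. J\<^sub>0 (?m q (Z q))"] J\<^sub>0(2)
      by (simp add: apply_field_def)
    then show ?thesis
      using mderiv_linear_compose[OF J\<^sub>0(1) smooth_fun_on_mderiv_apply[OF o smc on[OF that]] o c(2)] by simp
  qed
  note sJ = smooth_complex_structure[OF J]
  have "?m p ?N = 0"
    by (simp add: linear_diff[OF lin] J\<^sub>0(2)[OF c(2)] br X Y sJ dJ J\<^sub>02)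
  then show ?thesis
    using inj_mderiv_chart[OF c] linear_0[OF lin] by (metis injD)
qed

end

subsection \<open>Submersions\<close>

locale smooth_submersion = smooth_mfd M + N: smooth_mfd N
  for M :: "('m::{t2_space,second_countable_topology}, 'a::euclidean_space) chart set"
    and N :: "('n::{t2_space,second_countable_topology}, 'b::euclidean_space) chart set" +
  fixes \<pi> :: "'m \<Rightarrow> 'n"
  assumes smooth_proj: "smooth_map M N \<pi>" and surj_differential: "surj (differential M N \<pi> p)"
begin

lemma open_preimage_chart: "d \<in> N \<Longrightarrow> open (\<pi> -` fst d)"
  using smooth_proj N.open_chart_dom unfolding smooth_map_def
  by (metis continuous_on_open_vimage open_UNIV Int_UNIV_right)

lemma smooth_chart_proj:
  assumes "d \<in> N" shows "smooth_fun_on M (\<pi> -` fst d) (snd d \<circ> \<pi>)"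
  using smooth_proj assms unfolding smooth_map_def smooth_fun_on_def by blast

text \<open>\<open>vertical\<close> refers to a preferred chart at \<pi> p, which may change with p.
  By the chain rule through a transition map of N, this lemma and its converse below let one fixed
  chart d test verticality on a whole neighbourhood.\<close>

lemma vertical_chartI:
  assumes d: "d \<in> N" "\<pi> p \<in> fst d" and v: "mderiv M (snd d \<circ> \<pi>) p v = 0"
  shows "v \<in> vertical M N \<pi> p"
proof -
  let ?d = "chart_at N (\<pi> p)"
  let ?U = "\<pi> -` fst d \<inter> \<pi> -` fst ?d"
  let ?h = "snd ?d \<circ> chart_inv d"
  have "smooth_on (snd d ` (fst d \<inter> fst ?d)) ?h"
    using N.transition_smooth N.chart_at d by blast
  then have h: "?h differentiable (at ((snd d \<circ> \<pi>) p))"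
    by (rule smooth_on_differentiable)
       (use d N.chart_at[of "\<pi> p"] N.open_chart_image[OF d(1) N.open_chart_dom[OF N.chart_at(1)]] in auto)
  have lin: "linear (fderiv ?h ((snd d \<circ> \<pi>) p))"
    using linear_frechet_derivative[OF h] .
  have "differential M N \<pi> p v = mderiv M (\<lambda>q. ?h ((snd d \<circ> \<pi>) q)) p v"
    unfolding differential_def
    by (rule arg_cong[where f="\<lambda>f. f v"], rule mderiv_cong[of ?U])
       (use d N.chart_at[of "\<pi> p"] open_Int[OF open_preimage_chart[OF d(1)] open_preimage_chart[OF N.chart_at(1)]] in auto)
  also have "\<dots> = fderiv ?h ((snd d \<circ> \<pi>) p) (mderiv M (snd d \<circ> \<pi>) p v)"
    by (rule mderiv_compose[OF smooth_chart_proj[OF d(1)] open_preimage_chart[OF d(1)] _ h]) (use d in auto)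
  finally show ?thesis
    using v linear_0[OF lin] by (simp add: vertical_def)
qed

lemma vertical_chartD:
  assumes d: "d \<in> N" "\<pi> p \<in> fst d" and v: "v \<in> vertical M N \<pi> p"
  shows "mderiv M (snd d \<circ> \<pi>) p v = 0"
proof -
  let ?d = "chart_at N (\<pi> p)"
  let ?U = "\<pi> -` fst d \<inter> \<pi> -` fst ?d"
  let ?h = "snd d \<circ> chart_inv ?d"
  have "smooth_on (snd ?d ` (fst ?d \<inter> fst d)) ?h"
    using N.transition_smooth N.chart_at d by blast
  then have h: "?h differentiable (at ((snd ?d \<circ> \<pi>) p))"
    by (rule smooth_on_differentiable)
       (use d N.chart_at[of "\<pi> p"] N.open_chart_image[OF N.chart_at(1) N.open_chart_dom[OF d(1)]] in auto)
  have lin: "linear (fderiv ?h ((snd ?d \<circ> \<pi>) p))"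
    using linear_frechet_derivative[OF h] .
  have "mderiv M (snd d \<circ> \<pi>) p v = mderiv M (\<lambda>q. ?h ((snd ?d \<circ> \<pi>) q)) p v"
    by (rule arg_cong[where f="\<lambda>f. f v"], rule mderiv_cong[of ?U])
       (use d N.chart_at[of "\<pi> p"] open_Int[OF open_preimage_chart[OF d(1)] open_preimage_chart[OF N.chart_at(1)]] in auto)
  also have "\<dots> = fderiv ?h ((snd ?d \<circ> \<pi>) p) (mderiv M (snd ?d \<circ> \<pi>) p v)"
    by (rule mderiv_compose[OF smooth_chart_proj[OF N.chart_at(1)] open_preimage_chart[OF N.chart_at(1)] _ h])
       (use N.chart_at in auto)
  finally show ?thesis
    using v linear_0[OF lin] by (simp add: vertical_def differential_def)
qed

lemma linear_differential: "linear (differential M N \<pi> p)"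
  unfolding differential_def
  using N.chart_at by (intro linear_mderiv[OF smooth_chart_proj open_preimage_chart]) auto

lemma subspace_vertical: "subspace (vertical M N \<pi> p)"
  unfolding vertical_def using linear_subspace_kernel[OF linear_differential] .

text \<open>Vertical fields are those that annihilate the coordinates of \<pi>, and a commutator of
  two such derivations annihilates them again.\<close>

lemma lie_bracket_vertical:
  assumes U: "U \<in> sections M (vertical M N \<pi>)" and V: "V \<in> sections M (vertical M N \<pi>)"
  shows "lie_bracket M U V p \<in> vertical M N \<pi> p"
proof -
  let ?d = "chart_at N (\<pi> p)"
  let ?O = "\<pi> -` fst ?d"
  let ?F = "snd ?d \<circ> \<pi>"
  have O: "open ?O" "p \<in> ?O" using open_preimage_chart N.chart_at by auto
  have smF: "smooth_fun_on M ?O ?F" using smooth_chart_proj N.chart_at by blast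
  have 0: "mderiv M (\<lambda>q. mderiv M ?F q (Z q)) p v = 0" if Z: "Z \<in> sections M (vertical M N \<pi>)" for Z v
  proof -
    have "mderiv M (\<lambda>q. mderiv M ?F q (Z q)) p = mderiv M (\<lambda>q. 0) p"
      by (rule mderiv_cong[OF O])
         (use vertical_chartD[OF N.chart_at(1)] Z in \<open>auto simp: sections_def\<close>)
    then show ?thesis by simp
  qed
  have on: "smooth_field_on M ?O Z" if "Z \<in> sections M (vertical M N \<pi>)" for Z
    using that O smooth_field_on_subset unfolding smooth_field_iff sections_def by blast
  have "mderiv M ?F p (lie_bracket M U V p) = 0"
    using mderiv_lie_bracket[OF smF on[OF U] on[OF V] O] 0[OF U] 0[OF V] by simp
  then show ?thesis using vertical_chartI[OF N.chart_at] by blast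
qed

lemma vertical_section:
  assumes v: "v \<in> vertical M N \<pi> p"
  obtains V where "V \<in> sections M (vertical M N \<pi>)" "V p = v"
proof -
  let ?d = "chart_at N (\<pi> p)"
  let ?c = "chart_at M p"
  let ?U = "fst ?c \<inter> \<pi> -` fst ?d"
  let ?F = "snd ?d \<circ> \<pi>"
  have U: "open ?U" "?U \<subseteq> fst ?c" "p \<in> ?U"
    using open_preimage_chart[OF N.chart_at(1)] chart_at[of p] N.chart_at[of "\<pi> p"] open_chart_dom[OF chart_at(1)]
    by auto
  have smF: "smooth_fun_on M ?U ?F"
    using smooth_fun_on_subset[OF smooth_chart_proj open_preimage_chart U(1)] N.chart_at by blast
  have onto: "surj (mderiv M ?F p)" using surj_differential unfolding differential_def .
  have "mderiv M ?F p v = 0" using v unfolding vertical_def differential_def by blast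
  then obtain X where X: "smooth_field_on M ?U X" "X p = v" "\<forall>q\<in>?U. \<forall>b\<in>Basis. mderiv M ?F q (X q) \<bullet> b = 0"
    using local_kernel_field[OF chart_at(1) U smF onto finite_Basis order_refl, of v] by auto
  have Xv: "X q \<in> vertical M N \<pi> q" if "q \<in> ?U" for q
    using that X(3) N.chart_at by (intro vertical_chartI[of ?d]) (auto intro: euclidean_eqI)
  obtain Y where Y: "smooth_field M Y" "Y p = X p" "\<And>q. q \<notin> ?U \<Longrightarrow> Y q = 0" "\<And>q. \<exists>r. Y q = r *\<^sub>R X q"
    using extend_field[OF U(1,3) X(1)] by blast
  \<comment> \<open>Inside ?U, Y is a multiple of the vertical X; outside it is 0. Both lie in a
    subspace.\<close>
  have "Y q \<in> vertical M N \<pi> q" for q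
    using Y(3,4)[of q] Xv[of q] subspace_vertical[of q] subspace_0 subspace_scale by metis
  then show thesis using that[of Y] Y X by (auto simp: sections_def)
qed

text \<open>The strict drop in dimension provides, at every point, a nonzero vertical vector from
  which the mean curvature can be read off.\<close>

lemma vertical_nontrivial:
  assumes "DIM('b) < DIM('a)"
  obtains v where "v \<in> vertical M N \<pi> p" "v \<noteq> 0"
proof -
  have "\<not> inj (differential M N \<pi> p)"
    using linear_injective_imp_surjective dim_image_eq[OF linear_differential[of p], of UNIV] assms
      dim_subset_UNIV[of "range (differential M N \<pi> p)"] by auto
  then show thesis
    using that linear_injective_0[OF linear_differential[of p]] unfolding vertical_def by blast
qed

end

text \<open>Guarantees that a field which is nonzero at a point has nonzero length nearby.\<close>

lemma (in smooth_mfd) smooth_fun_continuous: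
  assumes "smooth_fun M f" shows "continuous_on UNIV f"
proof -
  have "isCont f p" for p
  proof -
    let ?c = "chart_at M p"
    have sm: "smooth_on (snd ?c ` fst ?c) (f \<circ> chart_inv ?c)"
      using assms chart_at(1) unfolding smooth_fun_def by blast
    then have "continuous_on (snd ?c ` fst ?c) (f \<circ> chart_inv ?c)"
      unfolding smooth_on_def by (metis Ck_on.simps(1))
    then have "continuous_on (fst ?c) ((f \<circ> chart_inv ?c) \<circ> snd ?c)"
      by (rule continuous_on_compose[OF chart_continuous[OF chart_at(1)]])
    then have "continuous_on (fst ?c) f"
      by (rule continuous_on_eq) (use chart_at(1)[of p] in auto)
    then show ?thesis
      using continuous_on_eq_continuous_at[OF open_chart_dom[OF chart_at(1)]] chart_at(2) by blast
  qed
  then show ?thesis by (simp add: continuous_at_imp_continuous_on)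
qed

subsection \<open>The covariant derivative of the complex structure\<close>

locale lck_levi_civita = smooth_mfd M
  for M :: "('m::{t2_space,second_countable_topology}, 'a::euclidean_space) chart set" +
  fixes J :: "'m \<Rightarrow> 'a \<Rightarrow> 'a" and g :: "'m \<Rightarrow> 'a \<Rightarrow> 'a \<Rightarrow> real" and \<omega> :: "'m \<Rightarrow> 'a \<Rightarrow> real"
    and nabla :: "('m \<Rightarrow> 'a) \<Rightarrow> ('m \<Rightarrow> 'a) \<Rightarrow> 'm \<Rightarrow> 'a"
  assumes lck: "lck_manifold M J g \<omega>" and levi_civita: "levi_civita M g nabla"
begin

lemma hermitian: "hermitian_manifold M J g"
  using lck unfolding lck_manifold_def by (rule conjunct1)

lemma complex: "complex_structure M J"
  using hermitian unfolding hermitian_manifold_def by (elim conjE)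

lemma metric: "riemannian_metric M g"
  using hermitian unfolding hermitian_manifold_def riemannian_manifold_def by (elim conjE)

sublocale g: pos_form "g p" for p
  using metric unfolding riemannian_metric_def by unfold_locales auto

lemma smooth_metric: "smooth_field M X \<Longrightarrow> smooth_field M Y \<Longrightarrow> smooth_fun M (\<lambda>p. g p (X p) (Y p))"
  using metric unfolding riemannian_metric_def by (elim conjE) blast

lemma linear_J: "linear (J p)" and J_J [simp]: "J p (J p v) = - v"
  using complex unfolding complex_structure_def by blast+

lemmas J_diff = linear_diff[OF linear_J]
  and J_minus = linear_neg[OF linear_J]
  and J_zero [simp] = linear_0[OF linear_J]

lemma g_J_J [simp]: "g p (J p u) (J p v) = g p u v"
  using hermitian unfolding hermitian_manifold_def by blast

lemma g_J: "g p (J p u) v = - g p u (J p v)"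
  using g_J_J[of p "J p u" v] by (simp add: g.minus_left)

abbreviation JF :: "('m \<Rightarrow> 'a) \<Rightarrow> 'm \<Rightarrow> 'a" where "JF \<equiv> apply_field J"

lemma JF_apply [simp]: "JF X p = J p (X p)"
  by (simp add: apply_field_def)

lemma JF_JF [simp]: "JF (JF X) = (\<lambda>p. - X p)"
  by (simp add: fun_eq_iff)

lemma smooth_JF: "smooth_field M X \<Longrightarrow> smooth_field M (JF X)"
  using smooth_complex_structure[OF complex] .

lemma
  assumes "smooth_field M X" "smooth_field M Y"
  shows smooth_nabla: "smooth_field M (nabla X Y)"
    and torsion_free: "lie_bracket M X Y p = nabla X Y p - nabla Y X p"
    and nabla_scaleR: "smooth_fun M f \<Longrightarrow>
      nabla X (\<lambda>q. f q *\<^sub>R Y q) p = field_deriv M X f p *\<^sub>R Y p + f p *\<^sub>R nabla X Y p"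
    and metric_compatible: "smooth_field M Z \<Longrightarrow>
      field_deriv M X (\<lambda>q. g q (Y q) (Z q)) p = g p (nabla X Y p) (Z p) + g p (Y p) (nabla X Z p)"
  using levi_civita assms unfolding levi_civita_def by (elim conjE, simp)+

lemma nabla_minus:
  "smooth_field M X \<Longrightarrow> smooth_field M Y \<Longrightarrow> nabla X (\<lambda>q. - Y q) p = - nabla X Y p"
  using nabla_scaleR[of X Y "\<lambda>_. -1" p] by (simp add: field_deriv_def)

lemma nabla_zero: "smooth_field M X \<Longrightarrow> nabla X (\<lambda>q. 0) p = 0"
  using nabla_scaleR[of X X "\<lambda>_. 0" p] by (simp add: field_deriv_def)

definition nabla_J :: "('m \<Rightarrow> 'a) \<Rightarrow> ('m \<Rightarrow> 'a) \<Rightarrow> 'm \<Rightarrow> 'a" where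
  "nabla_J X Y p = nabla X (JF Y) p - J p (nabla X Y p)"

text \<open>Differentiating J^2 = -1 shows that \<nabla>_X J anticommutes with J.\<close>

lemma nabla_J_JF:
  assumes "smooth_field M X" "smooth_field M Y"
  shows "nabla_J X (JF Y) p = - J p (nabla_J X Y p)"
  using assms by (simp add: nabla_J_def nabla_minus J_diff)

text \<open>J is skew for g and g is parallel, so \<nabla>_X J is skew too; the proof differentiates
  g(JY, Z) = g(-Y, JZ).\<close>

lemma nabla_J_skew:
  assumes X: "smooth_field M X" and Y: "smooth_field M Y" and Z: "smooth_field M Z"
  shows "g p (Y p) (nabla_J X Z p) = - g p (Z p) (nabla_J X Y p)"
proof -
  have "(\<lambda>q. g q (JF Y q) (Z q)) = (\<lambda>q. g q (- Y q) (JF Z q))"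
    by (simp add: fun_eq_iff g_J g.minus_left)
  then have "field_deriv M X (\<lambda>q. g q (JF Y q) (Z q)) p = field_deriv M X (\<lambda>q. g q (- Y q) (JF Z q)) p"
    by simp
  then show ?thesis
    unfolding metric_compatible[OF X smooth_JF[OF Y] Z]
      metric_compatible[OF X smooth_field_minus[OF Y] smooth_JF[OF Z]]
    by (simp add: nabla_J_def nabla_minus X Y g.expand g_J g.sym[of p "Z p"])
qed

text \<open>For a torsion-free connection d\<Omega> is the cyclic sum of covariant derivatives of
  \<Omega>, and metric compatibility gives (\<nabla>_X \<Omega>)(Y,Z) = g(Y, (\<nabla>_X J)
  Z).\<close>

lemma ext_deriv_fundamental_form:
  assumes X: "smooth_field M X" and Y: "smooth_field M Y" and Z: "smooth_field M Z"
  shows "ext_deriv2 M (fundamental_form J g) X Y Z p =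
    g p (Y p) (nabla_J X Z p) + g p (Z p) (nabla_J Y X p) + g p (X p) (nabla_J Z Y p)"
proof -
  have d: "field_deriv M A (\<lambda>q. fundamental_form J g q (B q) (C q)) p =
      g p (nabla A B p) (J p (C p)) + g p (B p) (nabla A (JF C) p)"
    if "smooth_field M A" "smooth_field M B" "smooth_field M C" for A B C
    using metric_compatible[OF that(1,2) smooth_JF[OF that(3)]]
    by (simp add: fundamental_form_def)
  have e: "g p (B p) (J p (nabla A C p)) = - g p (nabla A C p) (J p (B p))" for A B C
    using g_J[of p "nabla A C p" "B p"] g.sym[of p "J p (nabla A C p)" "B p"] by simp
  show ?thesis
    unfolding ext_deriv2_def d[OF X Y Z] d[OF Y Z X] d[OF Z X Y]
      torsion_free[OF X Y] torsion_free[OF Y Z] torsion_free[OF Z X]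
    unfolding fundamental_form_def nabla_J_def
    by (simp add: g.expand e)
qed

text \<open>The tensor \<open>g(Z, (\<nabla>\<^bsub>JX\<^esub> J) Y - J (\<nabla>\<^sub>X J) Y)\<close> is symmetric in \<open>X, Y\<close> since the Nijenhuis tensor
  vanishes, and skew in \<open>Y, Z\<close>; hence it is zero.\<close>

lemma nabla_J_JF_left:
  assumes X: "smooth_field M X" and Y: "smooth_field M Y" and Z: "smooth_field M Z"
  shows "g p (Y p) (nabla_J (JF X) Z p) = - g p (J p (Y p)) (nabla_J X Z p)"
proof -
  define S where "S X Y = nabla_J (JF X) Y p - J p (nabla_J X Y p)" for X Y
  define s where "s X Y Z = g p (Z p) (S X Y)" for X Y Z
  have S_sym: "S A B = S B A" if A: "smooth_field M A" and B: "smooth_field M B" for A B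
  proof -
    note sm = A B smooth_JF[OF A] smooth_JF[OF B]
    have "S A B - S B A = lie_bracket M (JF A) (JF B) p - J p (lie_bracket M (JF A) B p)
        - J p (lie_bracket M A (JF B) p) - lie_bracket M A B p"
      by (simp add: S_def nabla_J_def torsion_free sm J_diff algebra_simps)
    then show ?thesis using nijenhuis_vanishes[OF complex A B, of p] by simp
  qed
  have s_sym: "s A B C = s B A C" if "smooth_field M A" "smooth_field M B" for A B C
    using S_sym[OF that] by (simp add: s_def)
  have s_skew: "s A B C = - s A C B"
    if A: "smooth_field M A" and B: "smooth_field M B" and C: "smooth_field M C" for A B C
  proof -
    have 1: "g p (C p) (nabla_J (JF A) B p) = - g p (B p) (nabla_J (JF A) C p)"
      using nabla_J_skew[OF smooth_JF[OF A] C B] .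
    have "g p (J p (C p)) (nabla_J A B p) = - g p (B p) (nabla_J A (JF C) p)"
      using nabla_J_skew[OF A smooth_JF[OF C] B, of p] by simp
    then have "g p (C p) (J p (nabla_J A B p)) = - g p (B p) (J p (nabla_J A C p))"
      using g_J[of p "C p"] by (simp add: nabla_J_JF[OF A C] g.expand)
    with 1 show ?thesis by (simp add: s_def S_def g.expand)
  qed
  have "s X Z Y = - s X Y Z" using s_skew X Y Z by blast
  also have "s X Y Z = s Y X Z" using s_sym X Y by blast
  also have "s Y X Z = - s Y Z X" using s_skew X Y Z by blast
  also have "s Y Z X = s Z Y X" using s_sym Y Z by blast
  also have "s Z Y X = - s Z X Y" using s_skew X Y Z by blast
  also have "s Z X Y = s X Z Y" using s_sym X Z by blast
  finally have "s X Z Y = 0" by simp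
  then show ?thesis by (simp add: s_def S_def g.expand g_J)
qed

text \<open>The weak form of the l.c.K. formula for \<nabla>J. Replacing Y, Z by JY, JZ changes the
  sign of the term with \<nabla>_X J and preserves the terms that differentiate J along Y and Z; so
  subtracting the two values of d\<Omega> = \<omega> \<and> \<Omega> doubles the former and cancels
  the latter.\<close>

lemma nabla_J_formula:
  assumes X: "smooth_field M X" and Y: "smooth_field M Y" and Z: "smooth_field M Z"
  shows "2 * g p (Y p) (nabla_J X Z p) =
    wedge12 (\<omega> p) (fundamental_form J g p) (X p) (Y p) (Z p) -
    wedge12 (\<omega> p) (fundamental_form J g p) (X p) (J p (Y p)) (J p (Z p))"
proof -
  have d: "wedge12 (\<omega> p) (fundamental_form J g p) (A p) (B p) (C p) =
    g p (B p) (nabla_J A C p) + g p (C p) (nabla_J B A p) + g p (A p) (nabla_J C B p)"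
    if "smooth_field M A" "smooth_field M B" "smooth_field M C" for A B C
    using lck that ext_deriv_fundamental_form[OF that, of p] unfolding lck_manifold_def by metis
  note JY = smooth_JF[OF Y] and JZ = smooth_JF[OF Z]
  have 1: "g p (J p (Y p)) (nabla_J X (JF Z) p) = - g p (Y p) (nabla_J X Z p)"
    by (simp add: nabla_J_JF[OF X Z] g.expand)
  have 2: "g p (J p (Z p)) (nabla_J (JF Y) X p) = g p (Z p) (nabla_J Y X p)"
    using nabla_J_JF_left[OF Y JZ X, of p] by (simp add: g.expand)
  have "g p (J p (Y p)) (nabla_J (JF Z) X p) = g p (Y p) (nabla_J Z X p)"
    using nabla_J_JF_left[OF Z JY X, of p] by (simp add: g.expand)
  then have 3: "g p (X p) (nabla_J (JF Z) (JF Y) p) = g p (X p) (nabla_J Z Y p)"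
    using nabla_J_skew[OF JZ X JY, of p] nabla_J_skew[OF Z X Y, of p] by simp
  show ?thesis
    using d[OF X Y Z] d[OF X JY JZ] 1 2 3 by simp
qed

end

subsection \<open>Lagrangian submersions\<close>

locale lagrangian_lck_submersion =
  lck_levi_civita M J g \<omega> nabla + smooth_submersion M N \<pi>
  for M :: "('m::{t2_space,second_countable_topology}, 'a::euclidean_space) chart set"
    and N :: "('n::{t2_space,second_countable_topology}, 'b::euclidean_space) chart set"
    and J g \<omega> nabla \<pi> +
  fixes B\<^sub>1 :: "'m \<Rightarrow> 'a"
  assumes dim_less: "DIM('b) < DIM('a)"
    and lee: "is_lee_field g \<omega> B\<^sub>1"
    and lagrangian: "lagrangian_submersion M g J N \<pi>"
    and lee_vertical: "B\<^sub>1 p \<in> vertical M N \<pi> p"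
begin

abbreviation "V\<^sub>p \<equiv> vertical M N \<pi>"
abbreviation "H\<^sub>p \<equiv> horizontal M g N \<pi>"
abbreviation "\<Gamma>V \<equiv> sections M V\<^sub>p"
abbreviation "\<Gamma>H \<equiv> sections M H\<^sub>p"

lemma subspace_horizontal: "subspace (H\<^sub>p p)"
  unfolding horizontal_def by (rule g.subspace_orth_compl)

lemma vertical_eq: "V\<^sub>p p = orth_compl (g p) (H\<^sub>p p)"
  unfolding horizontal_def using g.orth_compl_orth_compl[OF subspace_vertical] by simp

lemma g_horizontal_vertical [simp]:
  assumes "h \<in> H\<^sub>p p" "v \<in> V\<^sub>p p" shows "g p h v = 0" "g p v h = 0"
  using assms g.sym[of p v h] unfolding horizontal_def orth_compl_def by auto

lemma J_vertical: "v \<in> V\<^sub>p p \<Longrightarrow> J p v \<in> H\<^sub>p p"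
  using lagrangian unfolding lagrangian_submersion_def by blast

lemma J_horizontal:
  assumes "h \<in> H\<^sub>p p" shows "J p h \<in> V\<^sub>p p"
proof -
  obtain v where "v \<in> V\<^sub>p p" "h = J p v"
    using assms lagrangian unfolding lagrangian_submersion_def by blast
  then show ?thesis using subspace_neg[OF subspace_vertical] by simp
qed

lemma \<omega>_eq: "\<omega> p v = g p v (B\<^sub>1 p)"
  using lee unfolding is_lee_field_def by simp

lemma \<Gamma>V_D: "X \<in> \<Gamma>V \<Longrightarrow> smooth_field M X" "X \<in> \<Gamma>V \<Longrightarrow> X p \<in> V\<^sub>p p"
  and \<Gamma>H_D: "X \<in> \<Gamma>H \<Longrightarrow> smooth_field M X" "X \<in> \<Gamma>H \<Longrightarrow> X p \<in> H\<^sub>p p"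
  unfolding sections_def by auto

lemma JF_\<Gamma>V: "X \<in> \<Gamma>V \<Longrightarrow> JF X \<in> \<Gamma>H" and JF_\<Gamma>H: "X \<in> \<Gamma>H \<Longrightarrow> JF X \<in> \<Gamma>V"
  unfolding sections_def using smooth_JF J_vertical J_horizontal by auto

lemma vert_\<Gamma>V: "X \<in> \<Gamma>V \<Longrightarrow> vert M g N \<pi> X = X"
  by (rule ext) (simp add: vert_def g.orth_proj_in subspace_vertical \<Gamma>V_D(2))

lemma horiz_\<Gamma>H: "X \<in> \<Gamma>H \<Longrightarrow> horiz M g N \<pi> X = X"
  by (rule ext) (simp add: horiz_def g.orth_proj_in subspace_horizontal \<Gamma>H_D(2))

lemma horiz_\<Gamma>V: "X \<in> \<Gamma>V \<Longrightarrow> horiz M g N \<pi> X = (\<lambda>p. 0)"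
  unfolding horiz_def
  by (rule ext, rule g.orth_proj_orth[OF subspace_horizontal], fold vertical_eq) (rule \<Gamma>V_D(2))

lemma orth_proj_zero [simp]: "orth_proj (g p) (V\<^sub>p p) 0 = 0" "orth_proj (g p) (H\<^sub>p p) 0 = 0"
  using g.orth_proj_in[OF subspace_vertical subspace_0[OF subspace_vertical]]
    g.orth_proj_in[OF subspace_horizontal subspace_0[OF subspace_horizontal]] by auto

text \<open>Every horizontal vector is J of a vertical one, and every vertical vector is the value
  of a section. Identities between values of the second fundamental form thus reduce to identities
  of \<open>cubic\<close>.\<close>

lemma horizontal_eqI:
  assumes "x \<in> H\<^sub>p p" "y \<in> H\<^sub>p p" "\<And>W. W \<in> \<Gamma>V \<Longrightarrow> g p x (J p (W p)) = g p y (J p (W p))"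
  shows "x = y"
proof -
  have "x - y \<in> H\<^sub>p p" using assms subspace_diff[OF subspace_horizontal] by blast
  then obtain v where v: "v \<in> V\<^sub>p p" "x - y = J p v"
    using lagrangian unfolding lagrangian_submersion_def by blast
  obtain W where W: "W \<in> \<Gamma>V" "W p = v" using vertical_section[OF v(1)] .
  have "g p (x - y) (J p (W p)) = 0" using assms(3)[OF W(1)] by (simp add: g.expand)
  then have "g p (x - y) (x - y) = 0" using v(2) W(2) by simp
  then show ?thesis by simp
qed

text \<open>The fibres are Lagrangian: \<Omega>(u,v) = g(u, Jv) vanishes on vertical pairs.\<close>

lemma wedge_vertical [simp]:
  assumes "u \<in> V\<^sub>p p" "v \<in> V\<^sub>p p" "w \<in> V\<^sub>p p"
  shows "wedge12 (\<omega> p) (fundamental_form J g p) u v w = 0"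
  using assms J_vertical by (simp add: wedge12_def fundamental_form_def)

subsection \<open>The second fundamental form of the fibres\<close>

definition sff :: "('m \<Rightarrow> 'a) \<Rightarrow> ('m \<Rightarrow> 'a) \<Rightarrow> 'm \<Rightarrow> 'a" where
  "sff U V p = orth_proj (g p) (H\<^sub>p p) (nabla U V p)"

definition cubic :: "('m \<Rightarrow> 'a) \<Rightarrow> ('m \<Rightarrow> 'a) \<Rightarrow> ('m \<Rightarrow> 'a) \<Rightarrow> 'm \<Rightarrow> real" where
  "cubic U V W p = g p (nabla U V p) (J p (W p))"

lemma sff_horizontal: "sff U V p \<in> H\<^sub>p p"
  unfolding sff_def by (rule g.orth_proj(1)[OF subspace_horizontal])

lemma g_sff: "W \<in> \<Gamma>V \<Longrightarrow> g p (sff U V p) (J p (W p)) = cubic U V W p"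
  unfolding sff_def cubic_def
  by (rule g.inner_orth_proj[OF subspace_horizontal]) (simp add: J_vertical \<Gamma>V_D)

text \<open>The antisymmetric part is the bracket of two vertical fields, which is vertical and so
  orthogonal to JW.\<close>

lemma cubic_sym12:
  assumes "U \<in> \<Gamma>V" "V \<in> \<Gamma>V" "W \<in> \<Gamma>V" shows "cubic U V W p = cubic V U W p"
proof -
  have "g p (lie_bracket M U V p) (J p (W p)) = 0"
    using lie_bracket_vertical[OF assms(1,2)] J_vertical \<Gamma>V_D(2)[OF assms(3)] by simp
  then show ?thesis
    using torsion_free[OF \<Gamma>V_D(1) \<Gamma>V_D(1), of U V p] assms by (simp add: cubic_def g.expand)
qed

text \<open>Differentiate g(V, JW) = 0 along U. The result is the claimed symmetry up to g(V,
  (\<nabla>_U J) W), which the l.c.K. formula shows to be zero.\<close>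

lemma cubic_sym23:
  assumes U: "U \<in> \<Gamma>V" and V: "V \<in> \<Gamma>V" and W: "W \<in> \<Gamma>V" shows "cubic U V W p = cubic U W V p"
proof -
  note sm = \<Gamma>V_D(1)[OF U] \<Gamma>V_D(1)[OF V] \<Gamma>V_D(1)[OF W]
  note ve = \<Gamma>V_D(2)[OF U, of p] \<Gamma>V_D(2)[OF V, of p] \<Gamma>V_D(2)[OF W, of p]
  \<comment> \<open>Verticality of the Lee field enters here: \<omega> kills the horizontal vectors
    JV and JW, while \<Omega>(JV, JW) = \<Omega>(V, W) = 0.\<close>
  have "wedge12 (\<omega> p) (fundamental_form J g p) (U p) (J p (V p)) (J p (W p)) = 0"
    using ve J_vertical lee_vertical by (simp add: wedge12_def fundamental_form_def \<omega>_eq g.expand g_J)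
  then have "g p (V p) (nabla_J U W p) = 0"
    using nabla_J_formula[OF sm(1,2,3), of p] ve by simp
  then have 1: "g p (V p) (nabla U (JF W) p) = - g p (nabla U W p) (J p (V p))"
    using g_J[of p "nabla U W p" "V p"] g.sym[of p "J p (nabla U W p)" "V p"]
    by (simp add: nabla_J_def g.expand)
  have "(\<lambda>q. g q (V q) (JF W q)) = (\<lambda>q. 0)"
    using \<Gamma>V_D(2) V W J_vertical by (auto simp: fun_eq_iff)
  then have "0 = g p (nabla U V p) (J p (W p)) + g p (V p) (nabla U (JF W) p)"
    using metric_compatible[OF sm(1,2) smooth_JF[OF sm(3)], of p] by (simp add: field_deriv_def)
  then show ?thesis using 1 by (simp add: cubic_def)
qed

lemma sff_sym:
  assumes "U \<in> \<Gamma>V" "V \<in> \<Gamma>V" shows "sff U V p = sff V U p"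
  by (rule horizontal_eqI[OF sff_horizontal sff_horizontal]) (simp add: g_sff cubic_sym12[OF assms])

text \<open>Tensoriality without any localisation: the symmetries of \<open>cubic\<close> move U
  into the last slot, where only its value at p counts.\<close>

lemma sff_zero:
  assumes "U \<in> \<Gamma>V" "V \<in> \<Gamma>V" "U p = 0" shows "sff U V p = 0"
proof (rule horizontal_eqI[OF sff_horizontal subspace_0[OF subspace_horizontal]])
  fix W assume W: "W \<in> \<Gamma>V"
  have "cubic U V W p = cubic U W V p" "cubic U W V p = cubic W U V p" "cubic W U V p = cubic W V U p"
    using cubic_sym12 cubic_sym23 assms W by blast+
  moreover have "cubic W V U p = 0" using assms by (simp add: cubic_def)
  ultimately show "g p (sff U V p) (J p (W p)) = g p 0 (J p (W p))"
    using g_sff[OF W] by simp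
qed

lemma sff_minus:
  assumes U: "U \<in> \<Gamma>V" and V: "V \<in> \<Gamma>V" shows "sff U (\<lambda>q. - V q) p = - sff U V p"
proof (rule horizontal_eqI[OF sff_horizontal subspace_neg[OF subspace_horizontal sff_horizontal]])
  fix W assume W: "W \<in> \<Gamma>V"
  show "g p (sff U (\<lambda>q. - V q) p) (J p (W p)) = g p (- sff U V p) (J p (W p))"
    using nabla_minus[OF \<Gamma>V_D(1)[OF U] \<Gamma>V_D(1)[OF V]]
    by (simp add: g_sff[OF W] cubic_def g.minus_left)
qed

lemma oneill_T_vertical:
  assumes "U \<in> \<Gamma>V" "V \<in> \<Gamma>V"
  shows "oneill_T M g nabla N \<pi> U V p = sff U V p"
  using assms nabla_zero[OF \<Gamma>V_D(1)]
  \<comment> \<open>The inner projections are evaluated on whole fields first, which leaves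
    \<nabla>_U 0 = 0 in the second summand; only then are the outer ones unfolded at p.\<close>
  by (simp add: oneill_T_def vert_\<Gamma>V horiz_\<Gamma>V sff_def) (simp add: vert_def horiz_def)

text \<open>Since JY is vertical, A_X JY is the horizontal part of \<nabla>_X JY = (\<nabla>_X J) Y
  + J \<nabla>_X Y. Paired with JV, the first summand produces the right-hand side of the condition
  on A and the second one the obstruction to total geodesy.\<close>

lemma g_oneill_A:
  assumes X: "X \<in> \<Gamma>H" and Y: "Y \<in> \<Gamma>H" and V: "V \<in> \<Gamma>V"
  shows "g p (oneill_A M g nabla N \<pi> X (JF Y) p) (J p (V p)) =
    1/2 * g p (J p (Y p)) (B\<^sub>1 p) * g p (X p) (J p (V p)) +
    1/2 * g p (X p) (Y p) * g p (B\<^sub>1 p) (V p) + g p (nabla X Y p) (V p)"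
proof -
  note sm = \<Gamma>H_D(1)[OF X] \<Gamma>H_D(1)[OF Y] \<Gamma>V_D(1)[OF V]
  note ve = \<Gamma>H_D(2)[OF X, of p] \<Gamma>H_D(2)[OF Y, of p] \<Gamma>V_D(2)[OF V, of p]
  have "oneill_A M g nabla N \<pi> X (JF Y) p = orth_proj (g p) (H\<^sub>p p) (nabla X (JF Y) p)"
    using X JF_\<Gamma>H[OF Y] nabla_zero[OF sm(1)]
    by (simp add: oneill_A_def vert_\<Gamma>V horiz_\<Gamma>V horiz_\<Gamma>H) (simp add: vert_def horiz_def)
  then have "g p (oneill_A M g nabla N \<pi> X (JF Y) p) (J p (V p)) = g p (nabla X (JF Y) p) (J p (V p))"
    using g.inner_orth_proj[OF subspace_horizontal J_vertical[OF ve(3)]] by simp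
  also have "\<dots> = g p (JF V p) (nabla_J X Y p) + g p (nabla X Y p) (V p)"
    by (simp add: nabla_J_def g.expand g.sym[of p "J p (V p)"] g.sym[of p "V p"])
  finally have A: "g p (oneill_A M g nabla N \<pi> X (JF Y) p) (J p (V p)) =
      g p (JF V p) (nabla_J X Y p) + g p (nabla X Y p) (V p)" .
  \<comment> \<open>Of the two wedge terms of the formula, the one on X, JV, Y vanishes because
    \<omega> kills horizontal vectors; the one on X, J(JV) = -V, JY gives both products.\<close>
  have "2 * g p (JF V p) (nabla_J X Y p) =
      g p (J p (Y p)) (B\<^sub>1 p) * g p (X p) (J p (V p)) + g p (X p) (Y p) * g p (B\<^sub>1 p) (V p)"
    unfolding nabla_J_formula[OF sm(1) smooth_JF[OF sm(3)] sm(2)]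
    using ve J_vertical[OF ve(3)] J_horizontal[OF ve(1)] J_horizontal[OF ve(2)]
      g.sym[of p "Y p" "X p"] g.sym[of p "B\<^sub>1 p" "V p"]
    by (simp add: wedge12_def fundamental_form_def \<omega>_eq g.minus_left g.minus_right J_minus)
  then show ?thesis unfolding A by simp
qed

text \<open>Paired with JW, T_V JX is \<open>cubic\<close> on V, JX, W. Moving JX to the last slot
  brings V and W together, where umbilicity applies, and J(JX) = -X accounts for the sign.\<close>

lemma umbilical_imp_T:
  assumes umb: "\<And>U V p. U \<in> \<Gamma>V \<Longrightarrow> V \<in> \<Gamma>V \<Longrightarrow> sff U V p = g p (U p) (V p) *\<^sub>R K p"
    and X: "X \<in> \<Gamma>H" and V: "V \<in> \<Gamma>V" and nz: "V p \<noteq> 0"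
  shows "oneill_T M g nabla N \<pi> V (JF X) p =
    (- g p (X p) (oneill_T M g nabla N \<pi> V V p) / g p (V p) (V p)) *\<^sub>R J p (V p)"
  unfolding oneill_T_vertical[OF V JF_\<Gamma>H[OF X]] oneill_T_vertical[OF V V]
proof (rule horizontal_eqI[OF sff_horizontal])
  let ?r = "- g p (X p) (sff V V p) / g p (V p) (V p)"
  show "?r *\<^sub>R J p (V p) \<in> H\<^sub>p p"
    using J_vertical[OF \<Gamma>V_D(2)[OF V]] subspace_scale[OF subspace_horizontal] by blast
  fix W assume W: "W \<in> \<Gamma>V"
  have r: "?r = - g p (X p) (K p)"
    using nz umb[OF V V] by (simp add: g.expand)
  have "g p (sff V (JF X) p) (J p (W p)) = cubic V W (JF X) p"
    using g_sff[OF W] cubic_sym23[OF V JF_\<Gamma>H[OF X] W] by simp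
  also have "\<dots> = g p (sff V W p) (J p (JF X p))"
    using g_sff[OF JF_\<Gamma>H[OF X]] by simp
  also have "\<dots> = - g p (V p) (W p) * g p (X p) (K p)"
    by (simp add: umb[OF V W] g.expand g.sym[of p "K p"])
  also have "\<dots> = g p (?r *\<^sub>R J p (V p)) (J p (W p))"
    unfolding r by (simp add: g.expand)
  finally show "g p (sff V (JF X) p) (J p (W p)) = g p (?r *\<^sub>R J p (V p)) (J p (W p))" .
qed

subsection \<open>The mean curvature field\<close>

text \<open>The only candidate when h(V,V) is a multiple of JV: pairing with JV gives h(V,V) =
  C(V,V,V) |V|^-2 JV, and umbilicity divides once more by |V|^2. Spelled with \<open>inverse\<close>
  to match the smoothness lemma for reciprocals.\<close>

definition mean_curv :: "('m \<Rightarrow> 'a) \<Rightarrow> 'm \<Rightarrow> 'a" where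
  "mean_curv V p = (cubic V V V p * inverse (g p (V p) (V p) * g p (V p) (V p))) *\<^sub>R J p (V p)"

context
  assumes T: "\<And>X V p. X \<in> \<Gamma>H \<Longrightarrow> V \<in> \<Gamma>V \<Longrightarrow> V p \<noteq> 0 \<Longrightarrow>
    oneill_T M g nabla N \<pi> V (JF X) p =
      (- g p (X p) (oneill_T M g nabla N \<pi> V V p) / g p (V p) (V p)) *\<^sub>R J p (V p)"
begin

lemma sff_mean_curv:
  assumes U: "U \<in> \<Gamma>V" and V: "V \<in> \<Gamma>V" and nz: "V p \<noteq> 0"
  shows "sff V U p = g p (V p) (U p) *\<^sub>R mean_curv V p"
proof -
  \<comment> \<open>The condition is applied to X = JZ, for which JX = -Z; it says that h(V,Z) is
    always parallel to JV. Pairing h(V,V) with JU then determines C(V,V,U) from C(V,V,V).\<close>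
  have 1: "sff V Z p = (cubic V V Z p / g p (V p) (V p)) *\<^sub>R J p (V p)" if Z: "Z \<in> \<Gamma>V" for Z
  proof -
    have "- sff V Z p = (- g p (J p (Z p)) (sff V V p) / g p (V p) (V p)) *\<^sub>R J p (V p)"
      using T[OF JF_\<Gamma>V[OF Z] V nz] oneill_T_vertical[OF V V]
        oneill_T_vertical[OF V JF_\<Gamma>H[OF JF_\<Gamma>V[OF Z]]] sff_minus[OF V Z] by simp
    then show ?thesis
      using g_sff[OF Z, of p V V] g.sym[of p "J p (Z p)"] by simp
  qed
  have "cubic V V U p = g p (sff V V p) (J p (U p))" using g_sff[OF U] by simp
  also have "\<dots> = cubic V V V p / g p (V p) (V p) * g p (V p) (U p)"
    unfolding 1[OF V] by (simp add: g.expand)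
  finally show ?thesis
    unfolding 1[OF U] mean_curv_def by (simp add: field_simps)
qed

text \<open>If V and W are not orthogonal at p, equating h(V,W) with h(W,V) and cancelling g(V,W)
  gives the claim.\<close>

lemma mean_curv_unique:
  assumes V: "V \<in> \<Gamma>V" "V p \<noteq> 0" and W: "W \<in> \<Gamma>V" "W p \<noteq> 0"
  shows "mean_curv V p = mean_curv W p"
proof -
  have eq: "mean_curv A p = mean_curv B p"
    if A: "A \<in> \<Gamma>V" "A p \<noteq> 0" and B: "B \<in> \<Gamma>V" "B p \<noteq> 0" and nz: "g p (A p) (B p) \<noteq> 0" for A B
  proof -
    have "g p (A p) (B p) *\<^sub>R mean_curv A p = g p (A p) (B p) *\<^sub>R mean_curv B p"
      using sff_mean_curv[OF B(1) A] sff_mean_curv[OF A(1) B] sff_sym[OF A(1) B(1), of p]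
        g.sym[of p "B p" "A p"] by metis
    then show ?thesis using nz by simp
  qed
  show ?thesis
  proof (cases "g p (V p) (W p) = 0")
    case True
    \<comment> \<open>Orthogonal V and W are compared through their sum, whose products with them
      are |V|^2 and |W|^2, both nonzero.\<close>
    let ?Z = "\<lambda>q. V q + W q"
    have Z: "?Z \<in> \<Gamma>V"
      using V W smooth_field_add subspace_add[OF subspace_vertical] unfolding sections_def by auto
    have VZ: "g p (V p) (?Z p) = g p (V p) (V p)" and WZ: "g p (W p) (?Z p) = g p (W p) (W p)"
      using True g.sym[of p "W p" "V p"] by (simp_all add: g.expand)
    then have "?Z p \<noteq> 0" using V(2) g.zero_right g.self_eq_0_iff by metis
    then show ?thesis using eq[OF V Z] eq[OF W Z] VZ WZ V(2) W(2) by simp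
  qed (use eq V W in blast)
qed

lemma umbilical: "\<exists>K\<in>\<Gamma>H. \<forall>U\<in>\<Gamma>V. \<forall>V\<in>\<Gamma>V. \<forall>p. sff U V p = g p (U p) (V p) *\<^sub>R K p"
proof -
  have ex: "\<exists>V. V \<in> \<Gamma>V \<and> V p \<noteq> 0" for p
    by (metis vertical_nontrivial[OF dim_less] vertical_section)
  \<comment> \<open>The choice may differ from point to point; uniqueness makes K agree, on the open
    set where a fixed V is nonzero, with \<open>mean_curv V\<close>, and this is what makes K
    smooth.\<close>
  define K where "K p = mean_curv (SOME V. V \<in> \<Gamma>V \<and> V p \<noteq> 0) p" for p
  have K: "K p = mean_curv V p" if "V \<in> \<Gamma>V" "V p \<noteq> 0" for V p
    unfolding K_def using someI_ex[OF ex[of p]] that by (blast intro: mean_curv_unique)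
  have "K p \<in> H\<^sub>p p" for p
  proof -
    obtain V where V: "V \<in> \<Gamma>V" "V p \<noteq> 0" using ex by blast
    then show ?thesis
      unfolding K[OF V] mean_curv_def
      using J_vertical[OF \<Gamma>V_D(2)] subspace_scale[OF subspace_horizontal] by blast
  qed
  moreover have "smooth_field_on M UNIV K"
  proof (rule smooth_field_on_local)
    fix p :: 'm
    obtain V where V: "V \<in> \<Gamma>V" "V p \<noteq> 0" using ex by blast
    let ?n = "\<lambda>q. g q (V q) (V q)"
    define O' where "O' = ?n -` (- {0})"
    have smV: "smooth_field M V" using \<Gamma>V_D V by blast
    have "continuous_on UNIV ?n" using smooth_fun_continuous[OF smooth_metric[OF smV smV]] .
    then have O': "open O'" "p \<in> O'"
      unfolding O'_def using V by (auto intro: open_vimage)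
    have on: "smooth_fun_on M O' f" if "smooth_fun M f" for f :: "'m \<Rightarrow> real"
      using that O' smooth_fun_on_subset unfolding smooth_fun_iff by blast
    have n: "smooth_fun_on M O' ?n" using on smooth_metric smV by blast
    have "smooth_fun M (cubic V V V)"
      using smooth_metric[OF smooth_nabla[OF smV smV] smooth_JF[OF smV]] unfolding cubic_def by simp
    then have "smooth_fun_on M O' (\<lambda>q. cubic V V V q * inverse (?n q * ?n q))"
      using n on O' by (intro smooth_fun_on_mult smooth_fun_on_inverse) (auto simp: O'_def)
    moreover have "smooth_field_on M O' (JF V)"
      using smooth_JF[OF smV] O' smooth_field_on_subset unfolding smooth_field_iff by blast
    ultimately have "smooth_field_on M O' (\<lambda>q. (cubic V V V q * inverse (?n q * ?n q)) *\<^sub>R JF V q)"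
      using O' by (intro smooth_field_on_scaleR)
    then have "smooth_field_on M O' K"
      by (rule smooth_field_on_cong[OF _ O'(1)])
         (use K[OF V(1)] in \<open>auto simp: O'_def mean_curv_def\<close>)
    then show "\<exists>S. open S \<and> p \<in> S \<and> S \<subseteq> UNIV \<and> smooth_field_on M S K" using O' by blast
  qed
  ultimately have "K \<in> \<Gamma>H" by (simp add: sections_def smooth_field_iff)
  moreover have "sff U V p = g p (U p) (V p) *\<^sub>R K p" if U: "U \<in> \<Gamma>V" and V: "V \<in> \<Gamma>V" for U V p
  proof (cases "U p = 0")
    \<comment> \<open>The condition on T is silent where the field vanishes, so this case rests on
      tensoriality.\<close>
    case True
    then show ?thesis using sff_zero[OF U V] by simp
  next
    case False
    then show ?thesis using sff_mean_curv[OF V U] K[OF U] by simp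
  qed
  ultimately show ?thesis by blast
qed

end

section \<open>Integrability, umbilicity and total geodesy of the two distributions\<close>

lemma lie_bracket_eq: "smooth_field M X \<Longrightarrow> smooth_field M Y \<Longrightarrow>
    lie_bracket M X Y = (\<lambda>p. nabla X Y p + - nabla Y X p)"
  by (simp add: fun_eq_iff torsion_free)

lemma integrable_vertical: "integrable_distribution M V\<^sub>p"
  unfolding integrable_distribution_def
proof (intro ballI)
  fix U V assume U: "U \<in> \<Gamma>V" and V: "V \<in> \<Gamma>V"
  have "smooth_field M (lie_bracket M U V)"
    unfolding lie_bracket_eq[OF \<Gamma>V_D(1)[OF U] \<Gamma>V_D(1)[OF V]]
    by (intro smooth_field_add smooth_field_minus smooth_nabla \<Gamma>V_D(1) U V)
  then show "lie_bracket M U V \<in> \<Gamma>V"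
    using lie_bracket_vertical[OF U V] by (simp add: sections_def)
qed

lemma totally_umbilical_vertical_iff:
  "totally_umbilical_foliation M g nabla V\<^sub>p \<longleftrightarrow>
    (\<exists>K\<in>\<Gamma>H. \<forall>U\<in>\<Gamma>V. \<forall>V\<in>\<Gamma>V. \<forall>p. sff U V p = g p (U p) (V p) *\<^sub>R K p)"
  unfolding totally_umbilical_foliation_def horizontal_def[symmetric] sff_def[symmetric]
  using integrable_vertical by simp

text \<open>Integrability comes for free on the right: if \<nabla>_X Y is always horizontal, so is
  the bracket, being a difference of two such fields. Testing against sections suffices because each
  vertical vector extends to one.\<close>

lemma totally_geodesic_horizontal_iff:
  "totally_geodesic_foliation M nabla H\<^sub>p \<longleftrightarrow>
    (\<forall>X\<in>\<Gamma>H. \<forall>Y\<in>\<Gamma>H. \<forall>V\<in>\<Gamma>V. \<forall>p. g p (nabla X Y p) (V p) = 0)" (is "?l \<longleftrightarrow> ?r")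
proof
  assume ?l
  then show ?r
    unfolding totally_geodesic_foliation_def by (metis \<Gamma>H_D(2) \<Gamma>V_D(2) g_horizontal_vertical(1))
next
  assume r: ?r
  have nab: "nabla X Y \<in> \<Gamma>H" if X: "X \<in> \<Gamma>H" and Y: "Y \<in> \<Gamma>H" for X Y
  proof -
    have "g p (nabla X Y p) v = 0" if v: "v \<in> V\<^sub>p p" for p v
    proof -
      obtain V where "V \<in> \<Gamma>V" "V p = v" using vertical_section[OF v] .
      then show ?thesis using r X Y by blast
    qed
    then have "nabla X Y p \<in> H\<^sub>p p" for p
      unfolding horizontal_def orth_compl_def by blast
    then show ?thesis
      using smooth_nabla[OF \<Gamma>H_D(1)[OF X] \<Gamma>H_D(1)[OF Y]] by (simp add: sections_def)
  qed
  moreover have "lie_bracket M X Y \<in> \<Gamma>H" if X: "X \<in> \<Gamma>H" and Y: "Y \<in> \<Gamma>H" for X Y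
  proof -
    have "smooth_field M (\<lambda>p. nabla X Y p + - nabla Y X p)"
      using nab X Y \<Gamma>H_D(1) by (intro smooth_field_add smooth_field_minus) auto
    moreover have "nabla X Y p + - nabla Y X p \<in> H\<^sub>p p" for p
      using \<Gamma>H_D(2)[OF nab[OF X Y]] \<Gamma>H_D(2)[OF nab[OF Y X]]
      by (intro subspace_add subspace_neg subspace_horizontal)
    ultimately show ?thesis
      using lie_bracket_eq[OF \<Gamma>H_D(1)[OF X] \<Gamma>H_D(1)[OF Y]] by (simp add: sections_def)
  qed
  ultimately show ?l
    unfolding totally_geodesic_foliation_def integrable_distribution_def by blast
qed

end

text \<open>The equivalence splits: the condition on T is umbilicity of the fibres, the condition on
  A is total geodesy of the horizontal distribution, and neither half uses the other.\<close>

theorem theorem5p4: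
  fixes M :: "('m::{t2_space,second_countable_topology}, 'a::euclidean_space) chart set"
    and N :: "('n::{t2_space,second_countable_topology}, 'b::euclidean_space) chart set"
    and g :: "'m \<Rightarrow> 'a \<Rightarrow> 'a \<Rightarrow> real"
    and g\<^sub>B :: "'n \<Rightarrow> 'b \<Rightarrow> 'b \<Rightarrow> real"
    and J :: "'m \<Rightarrow> 'a \<Rightarrow> 'a"
    and \<omega> :: "'m \<Rightarrow> 'a \<Rightarrow> real"
    and B\<^sub>1 :: "'m \<Rightarrow> 'a"
    and nabla :: "('m \<Rightarrow> 'a) \<Rightarrow> ('m \<Rightarrow> 'a) \<Rightarrow> 'm \<Rightarrow> 'a"
    and \<pi> :: "'m \<Rightarrow> 'n"
  assumes "lck_manifold M J g \<omega>"
    and "is_lee_field g \<omega> B\<^sub>1"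
    and "levi_civita M g nabla"
    and "riemannian_manifold N g\<^sub>B"
    and "riemannian_submersion M g N g\<^sub>B \<pi>"
    and "lagrangian_submersion M g J N \<pi>"
    and "B\<^sub>1 \<in> sections M (vertical M N \<pi>)"
  shows "locally_twisted_product M g nabla (horizontal M g N \<pi>) (vertical M N \<pi>) \<longleftrightarrow>
    (\<forall>X \<in> sections M (horizontal M g N \<pi>). \<forall>V \<in> sections M (vertical M N \<pi>). \<forall>p. V p \<noteq> 0 \<longrightarrow>
       oneill_T M g nabla N \<pi> V (apply_field J X) p =
         (- g p (X p) (oneill_T M g nabla N \<pi> V V p) / g p (V p) (V p)) *\<^sub>R J p (V p)) \<and>
    (\<forall>X \<in> sections M (horizontal M g N \<pi>). \<forall>Y \<in> sections M (horizontal M g N \<pi>).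
     \<forall>V \<in> sections M (vertical M N \<pi>). \<forall>p.
       g p (oneill_A M g nabla N \<pi> X (apply_field J Y) p) (J p (V p)) =
         1/2 * g p (J p (Y p)) (B\<^sub>1 p) * g p (X p) (J p (V p)) +
         1/2 * g p (X p) (Y p) * g p (B\<^sub>1 p) (V p))"
    (is "_ \<longleftrightarrow> ?T \<and> ?A")
proof -
  interpret lagrangian_lck_submersion M N J g \<omega> nabla \<pi> B\<^sub>1
    using assms unfolding lck_manifold_def hermitian_manifold_def riemannian_manifold_def
      riemannian_submersion_def sections_def
    by unfold_locales (auto simp: lck_manifold_def hermitian_manifold_def riemannian_manifold_def)
  have T: "totally_umbilical_foliation M g nabla V\<^sub>p \<longleftrightarrow> ?T"
    unfolding totally_umbilical_vertical_iff
  proof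
    assume "\<exists>K\<in>\<Gamma>H. \<forall>U\<in>\<Gamma>V. \<forall>V\<in>\<Gamma>V. \<forall>p. sff U V p = g p (U p) (V p) *\<^sub>R K p"
    then obtain K where K: "\<And>U V p. U \<in> \<Gamma>V \<Longrightarrow> V \<in> \<Gamma>V \<Longrightarrow> sff U V p = g p (U p) (V p) *\<^sub>R K p"
      by blast
    show ?T by (intro ballI allI impI umbilical_imp_T[OF K])
  next
    assume R: ?T
    show "\<exists>K\<in>\<Gamma>H. \<forall>U\<in>\<Gamma>V. \<forall>V\<in>\<Gamma>V. \<forall>p. sff U V p = g p (U p) (V p) *\<^sub>R K p"
      by (rule umbilical) (rule R[rule_format])
  qed
  have A: "totally_geodesic_foliation M nabla H\<^sub>p \<longleftrightarrow> ?A"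
    unfolding totally_geodesic_horizontal_iff by (simp add: g_oneill_A)
  show ?thesis
    unfolding locally_twisted_product_def A T using vertical_eq by blast
qed

end
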